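(* Let $\mathcal X\subset\mathbb R^n$, let $g$ and $h_1,\dots,h_k$ be real-valued $C^\infty$ functions of $(x,y)\in\mathcal X\times\mathbb R^m$, and let $\mathcal Y(x)=\{y\in\mathbb R^m: h_i(x,y)\le 0,\ i=1,\dots,k\}$ be nonempty for every $x\in\mathcal X$. Fix $x\in\mathcal X$. Suppose $\mathcal Y(x)$ is bounded and LICQ holds for the lower-level problem $\min_{y\in\mathcal Y(x)}g(x,y)$ at $x$. Then for any compact sets $K_{\rm in},K_{\rm out}\subset\mathbb R^m$ with $\mathcal Y(x)\subset\operatorname{int}(K_{\rm in})$ and $K_{\rm in}\subset\operatorname{int}(K_{\rm out})$ there exists a constant $\epsilon=\epsilon(x,K_{\rm in},K_{\rm out})>0$ such that the following holds: for any smooth perturbations $r_1,\dots,r_k$ of the constraint functions satisfying $\max_i\|r_i(x,\cdot)\|_{C^2(K_{\rm out})}\le\epsilon$, the set $\widetilde{\mathcal Y}(x)\cap K_{\rm in}$, where $\widetilde{\mathcal Y}(x)=\{y\in\mathbb R^m: h_i(x,y)+r_i(x,y)\le 0,\ i=1,\dots,k\}$, has the same natural stratification as $\mathcal Y(x)$; specifically, there exists a stratification-preserving diffeomorphism between $\mathcal Y(x)$ and $\widetilde{\mathcal Y}(x)\cap K_{\rm in}$.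
   Context: LICQ: let $\mathcal J(x,y)=\{i: h_i(x,y)=0\}$. LICQ holds for the lower-level problem at $x$ if for every $y\in\mathcal Y(x)$ the vectors $\{\nabla_y h_i(x,y): i\in\mathcal J(x,y)\}$ are linearly independent. Compact-local norm: for compact $K\subset\mathbb R^m$ and $\phi$ twice continuously differentiable near $K$, $\|\phi\|_{C^2(K)}=\max\{\sup_{y\in K}|\phi(y)|,\ \sup_{y\in K}\|\nabla\phi(y)\|,\ \sup_{y\in K}\|\nabla^2\phi(y)\|_{\rm op}\}$; for $\phi(x,y)$, $\|\phi(x,\cdot)\|_{C^2(K)}$ is this norm in the variable $y$ with $x$ fixed. MGB: a subset $X\subset\mathbb R^N$ is a manifold with generalized boundary (of class $C^\infty$) if for each $p_0\in X$ there is a local $C^\infty$ coordinate system $\psi:U\to V$ of $\mathbb R^N$ with $\psi(p_0)=0$ and integers $q,p\ge 0$ (possibly depending on $p_0$) such that $\psi(U\cap X)=\{v\in V: v_1=\dots=v_q=0,\ v_{q+1}\ge 0,\dots,v_{q+p}\ge 0\}$. If $X$ has dimension $s$ (i.e. $q=N-s$ everywhere), put $\Sigma^\ell=\{p_0\in X: p(p_0)=s-\ell\}$; the path-components of $\Sigma^\ell$ are the $\ell$-dimensional strata, and together they form the natural stratification. For a set defined by smooth inequality constraints satisfying LICQ the strata are the connected components of the sets of points sharing a given active index set. A map between subsets of Euclidean spaces is $C^\infty$ if locally it extends to a $C^\infty$ map on an open set; a diffeomorphism is a bijection that is $C^\infty$ with $C^\infty$ inverse. It is stratification-preserving if it maps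 each stratum of one set onto a stratum of the other. *)

theory Defs
  imports "HOL-Analysis.Analysis"
begin

text \<open>
  \<open>Ck_open k U f\<close> is meant for open \<open>U\<close> only: \<open>f\<close> is \<open>k\<close> times continuously differentiable
  on \<open>U\<close>. Iterating over directional derivatives keeps the codomain fixed.
\<close>

primrec Ck_open :: "nat \<Rightarrow> 'a set \<Rightarrow> ('a::euclidean_space \<Rightarrow> 'b::euclidean_space) \<Rightarrow> bool" where
  "Ck_open 0 U f \<longleftrightarrow> continuous_on U f"
| "Ck_open (Suc k) U f \<longleftrightarrow>
     (\<forall>x\<in>U. f differentiable (at x)) \<and>
     (\<forall>v. Ck_open k U (\<lambda>x. frechet_derivative f (at x) v))"

definition smooth_on :: "'a set \<Rightarrow> ('a::euclidean_space \<Rightarrow> 'b::euclidean_space) \<Rightarrow> bool" where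
  "smooth_on S f \<longleftrightarrow>
     (\<forall>p\<in>S. \<exists>U F. open U \<and> p \<in> U \<and> (\<forall>k. Ck_open k U F) \<and> (\<forall>z\<in>U \<inter> S. F z = f z))"

definition diffeomorphism ::
    "('a::euclidean_space \<Rightarrow> 'b::euclidean_space) \<Rightarrow> 'a set \<Rightarrow> 'b set \<Rightarrow> bool" where
  "diffeomorphism f S T \<longleftrightarrow> bij_betw f S T \<and> smooth_on S f \<and> smooth_on T (inv_into S f)"

definition gradient :: "('a::euclidean_space \<Rightarrow> real) \<Rightarrow> 'a \<Rightarrow> 'a" where
  "gradient f y = (THE D. GDERIV f y :> D)"

text \<open>
  The Hessian is the derivative of the gradient field. The suprema are real-valued, so the
  norm is meaningful for nonempty compact \<open>K\<close> and functions that are twice continuously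
  differentiable near \<open>K\<close>.
\<close>

definition C2_norm_on :: "'a set \<Rightarrow> ('a::euclidean_space \<Rightarrow> real) \<Rightarrow> real" where
  "C2_norm_on K f =
     Max {(SUP y\<in>K. \<bar>f y\<bar>),
          (SUP y\<in>K. norm (gradient f y)),
          (SUP y\<in>K. onorm (frechet_derivative (gradient f) (at y)))}"

definition feasible :: "nat \<Rightarrow> (nat \<Rightarrow> 'x \<Rightarrow> 'y \<Rightarrow> real) \<Rightarrow> 'x \<Rightarrow> 'y set" where
  "feasible k h x = {y. \<forall>i\<in>{1..k}. h i x y \<le> 0}"

definition active :: "nat \<Rightarrow> (nat \<Rightarrow> 'x \<Rightarrow> 'y \<Rightarrow> real) \<Rightarrow> 'x \<Rightarrow> 'y \<Rightarrow> nat set" where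
  "active k h x y = {i\<in>{1..k}. h i x y = 0}"

text \<open>
  Independence is that of the indexed family of gradients: without injectivity, two active
  constraints with equal gradients would be identified.
\<close>

definition LICQ :: "nat \<Rightarrow> (nat \<Rightarrow> 'x \<Rightarrow> 'y::euclidean_space \<Rightarrow> real) \<Rightarrow> 'x \<Rightarrow> bool" where
  "LICQ k h x \<longleftrightarrow>
     (\<forall>y\<in>feasible k h x.
        inj_on (\<lambda>i. gradient (h i x) y) (active k h x y) \<and>
        independent ((\<lambda>i. gradient (h i x) y) ` active k h x y))"

text \<open>
  \<open>mgb_at X p0 q p\<close>: near \<open>p0\<close>, in suitable smooth coordinates centred at \<open>p0\<close>, the set \<open>X\<close> is
  given by the vanishing of \<open>q\<close> coordinates and the nonnegativity of \<open>p\<close> further ones. The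
  index type is unordered, so disjoint index sets \<open>Q\<close> and \<open>P\<close> of these sizes replace the
  ranges \<open>1, ..., q\<close> and \<open>q + 1, ..., q + p\<close>; this is a renumbering of the coordinates.
\<close>

definition mgb_at :: "(real^'m) set \<Rightarrow> real^'m \<Rightarrow> nat \<Rightarrow> nat \<Rightarrow> bool" where
  "mgb_at X p0 q p \<longleftrightarrow>
     (\<exists>(U :: (real^'m) set) (V :: (real^'m) set) \<psi> Q P.
        open U \<and> open V \<and> p0 \<in> U \<and> diffeomorphism \<psi> U V \<and> \<psi> p0 = 0 \<and>
        Q \<inter> P = {} \<and> card Q = q \<and> card P = p \<and>
        \<psi> ` (U \<inter> X) = {v\<in>V. (\<forall>i\<in>Q. v $ i = 0) \<and> (\<forall>i\<in>P. v $ i \<ge> 0)})"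

definition manifold_gb :: "nat \<Rightarrow> (real^'m) set \<Rightarrow> bool" where
  "manifold_gb s X \<longleftrightarrow> (\<forall>p0\<in>X. \<exists>q p. q + s = CARD('m) \<and> mgb_at X p0 q p)"

definition Sigma_set :: "nat \<Rightarrow> (real^'m) set \<Rightarrow> nat \<Rightarrow> (real^'m) set" where
  "Sigma_set s X l = {p0\<in>X. \<exists>q p. q + s = CARD('m) \<and> p + l = s \<and> mgb_at X p0 q p}"

definition strata :: "nat \<Rightarrow> (real^'m) set \<Rightarrow> nat \<Rightarrow> (real^'m) set set" where
  "strata s X l = path_component_set (Sigma_set s X l) ` Sigma_set s X l"

definition natural_stratification :: "nat \<Rightarrow> (real^'m) set \<Rightarrow> (real^'m) set set" where
  "natural_stratification s X = (\<Union>l. strata s X l)"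

definition stratification_preserving ::
    "nat \<Rightarrow> (real^'m \<Rightarrow> real^'m) \<Rightarrow> (real^'m) set \<Rightarrow> (real^'m) set \<Rightarrow> bool" where
  "stratification_preserving s f X Y \<longleftrightarrow>
     (\<lambda>S. f ` S) ` natural_stratification s X = natural_stratification s Y"

end

theory Submission
  imports Defs
begin

text \<open>
  Near a point \<open>p\<close> of \<open>Y\<close>, LICQ provides vectors dual to the active gradients. They
  yield a map of the form identity plus small contraction, hence a global diffeomorphism \<open>E\<close>, that
  turns the constraints active at \<open>p\<close> into affine functions. If the constraints are changed slightly
  by a perturbation cut off near \<open>p\<close>, the corresponding map \<open>F\<close> is again of this form, and
  \<open>F\<^sup>-\<^sup>1 \<circ> E\<close> carries the old feasible set to the new one. Covering \<open>Y\<close> by finitely many such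
  neighbourhoods, the perturbation \<open>r\<close> is switched on in finitely many steps
  \<open>h + \<sigma> r \<mapsto> h + (\<sigma> + (1 - \<sigma>) \<theta>) r\<close>, with bump functions \<open>\<theta>\<close>. The composite is a diffeomorphism
  of the whole space mapping \<open>Y\<close> onto \<open>Y'\<close>, so it preserves all notions defined by local
  coordinates, in particular the stratification.
\<close>

section \<open>Calculus of smooth maps\<close>

text \<open>The active set varies from point to point, so no single map straightens all constraints,
  and local diffeomorphisms near different points need not agree on overlaps. Changing the
  constraint functions themselves, in one ball at a time, makes gluing unnecessary: each step fixes
  all points where the cutoff does not grow. LICQ is used only at points of \<open>Y\<close> and
  only for \<open>h\<close>; the intermediate functions stay so close to \<open>h\<close> that the
  dual vectors found for \<open>h\<close> at \<open>p\<close> straighten them too. Cutoffs and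
  neighbourhoods are chosen before \<open>r\<close>, hence each step imposes one bound on
  \<open>r\<close>, and the least of finitely many bounds serves as \<epsilon>. Points away from
  \<open>Y\<close> are the other obstacle, since the perturbation might create feasible points
  there. In the compact set a positive gap forbids this; outside it the cutoff is 0, and what the
  full perturbed set contains there is discarded by the intersection in the claim.\<close>

lemma linear_eq_sum_Basis:
  fixes D :: "'a::euclidean_space \<Rightarrow> 'b::real_vector"
  assumes "linear D"
  shows "D v = (\<Sum>b\<in>Basis. (v \<bullet> b) *\<^sub>R D b)"
proof -
  have "D v = D (\<Sum>b\<in>Basis. (v \<bullet> b) *\<^sub>R b)" by (simp only: euclidean_representation)
  then show ?thesis using assms by (simp only: linear_sum linear_scale)
qed

text \<open>The sum over the basis replaces the operator norm because, for a derivative, it is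
  visibly continuous in the base point. This yields bounds on compact sets and smallness near a
  point.\<close>

lemma norm_linear_le_Basis:
  fixes D :: "'a::euclidean_space \<Rightarrow> 'b::real_normed_vector"
  assumes "linear D"
  shows "norm (D v) \<le> (\<Sum>b\<in>Basis. norm (D b)) * norm v"
proof -
  have "D v = (\<Sum>b\<in>Basis. (v \<bullet> b) *\<^sub>R D b)" by (rule linear_eq_sum_Basis[OF assms])
  also have "norm \<dots> \<le> (\<Sum>b\<in>Basis. norm (D b) * norm v)"
  proof (rule sum_norm_le)
    fix b :: 'a assume "b \<in> Basis"
    then have "\<bar>v \<bullet> b\<bar> \<le> norm v" by (rule Basis_le_norm)
    then show "norm ((v \<bullet> b) *\<^sub>R D b) \<le> norm (D b) * norm v"
      by (simp add: mult.commute[of "norm (D b)"] mult_right_mono)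
  qed
  finally show ?thesis by (simp add: sum_distrib_right)
qed

lemma frechet_derivative_cong_open:
  assumes "open U" "x \<in> U" "\<And>y. y \<in> U \<Longrightarrow> f y = g y"
  shows "frechet_derivative f (at x) = frechet_derivative g (at x)"
proof -
  have "(f has_derivative D) (at x) \<longleftrightarrow> (g has_derivative D) (at x)" for D
    using assms by (metis has_derivative_transform_within_open)
  then show ?thesis by (simp add: frechet_derivative_def)
qed

lemma Ck_open_cong:
  assumes "open U" "\<And>x. x \<in> U \<Longrightarrow> f x = g x"
  shows "Ck_open k U f \<longleftrightarrow> Ck_open k U g"
  using assms(2)
proof (induction k arbitrary: f g)
  case 0
  then show ?case by (simp cong: continuous_on_cong)
next
  case (Suc k)
  have 1: "f differentiable at x \<longleftrightarrow> g differentiable at x" if "x \<in> U" for x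
    unfolding differentiable_def using assms(1) that Suc.prems
    by (metis has_derivative_transform_within_open)
  have 2: "Ck_open k U (\<lambda>x. frechet_derivative f (at x) v) \<longleftrightarrow>
           Ck_open k U (\<lambda>x. frechet_derivative g (at x) v)" for v
    using frechet_derivative_cong_open[OF assms(1) _ Suc.prems] by (intro Suc.IH) simp
  show ?case using 1 2 by simp
qed

text \<open>Lets a derivative be presented by any formula valid on \<open>U\<close>, instead of
  through the choice operator behind \<open>frechet_derivative\<close>.\<close>

lemma Ck_open_SucI:
  assumes "open U" "\<And>x. x \<in> U \<Longrightarrow> (f has_derivative f' x) (at x)"
    "\<And>v. Ck_open k U (\<lambda>x. f' x v)"
  shows "Ck_open (Suc k) U f"
proof -
  have "frechet_derivative f (at x) = f' x" if "x \<in> U" for x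
    using assms(2)[OF that] frechet_derivative_at by metis
  then have "Ck_open k U (\<lambda>x. frechet_derivative f (at x) v)" for v
    using Ck_open_cong[OF assms(1), of "\<lambda>x. frechet_derivative f (at x) v" "\<lambda>x. f' x v"] assms(3)
    by simp
  moreover have "f differentiable at x" if "x \<in> U" for x
    using assms(2)[OF that] differentiable_def by blast
  ultimately show ?thesis by simp
qed

lemma Ck_open_Suc_has_derivative:
  assumes "Ck_open (Suc k) U f" "x \<in> U"
  shows "(f has_derivative frechet_derivative f (at x)) (at x)"
  using assms frechet_derivative_works by auto

lemma Ck_open_SucD: "Ck_open (Suc k) U f \<Longrightarrow> Ck_open k U f"
proof (induction k arbitrary: f)
  case 0
  then show ?case
    by (auto intro!: continuous_at_imp_continuous_on differentiable_imp_continuous_within)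
next
  case (Suc k)
  from Suc.prems have "\<forall>x\<in>U. f differentiable at x"
    "\<And>v. Ck_open k U (\<lambda>x. frechet_derivative f (at x) v)"
    using Suc.IH by (auto simp del: Ck_open.simps(2) simp: Ck_open.simps(2)[of "Suc k"])
  then show ?case by simp
qed

lemma Ck_open_subset: "Ck_open k U f \<Longrightarrow> V \<subseteq> U \<Longrightarrow> Ck_open k V f"
  by (induction k arbitrary: f) (auto intro: continuous_on_subset)

lemma Ck_open_locally:
  assumes "\<And>x. x \<in> U \<Longrightarrow> \<exists>N. open N \<and> x \<in> N \<and> Ck_open k N f"
  shows "Ck_open k U f"
  using assms
proof (induction k arbitrary: f)
  case 0
  then have "isCont f x" if "x \<in> U" for x
    using that by (metis Ck_open.simps(1) continuous_on_eq_continuous_at)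
  then show ?case by (simp add: continuous_at_imp_continuous_on)
next
  case (Suc k)
  have "f differentiable at x" if "x \<in> U" for x
    using Suc.prems[OF that] by auto
  moreover have "Ck_open k U (\<lambda>x. frechet_derivative f (at x) v)" for v
    using Suc.prems by (intro Suc.IH) fastforce
  ultimately show ?case by simp
qed

lemma Ck_open_const: "open U \<Longrightarrow> Ck_open k U (\<lambda>x. c)"
proof (induction k arbitrary: c)
  case (Suc k)
  then show ?case by (intro Ck_open_SucI[where f' = "\<lambda>_ _. 0"]) auto
qed simp

lemma Ck_open_bounded_linear:
  assumes "open U" "bounded_linear f"
  shows "Ck_open k U f"
proof (cases k)
  case 0
  then show ?thesis using assms linear_continuous_on by auto
next
  case (Suc l)
  show ?thesis unfolding Suc
    by (rule Ck_open_SucI[where f' = "\<lambda>_. f"])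
      (use assms bounded_linear_imp_has_derivative Ck_open_const in auto)
qed

lemma Ck_open_add:
  assumes "open U" "Ck_open k U f" "Ck_open k U g"
  shows "Ck_open k U (\<lambda>x. f x + g x)"
  using assms(2,3)
proof (induction k arbitrary: f g)
  case 0
  then show ?case by (simp add: continuous_on_add)
next
  case (Suc k)
  show ?case
  proof (rule Ck_open_SucI[where f' = "\<lambda>x v. frechet_derivative f (at x) v + frechet_derivative g (at x) v"])
    show "((\<lambda>x. f x + g x) has_derivative (\<lambda>v. frechet_derivative f (at x) v + frechet_derivative g (at x) v)) (at x)"
      if "x \<in> U" for x
      using Ck_open_Suc_has_derivative[OF Suc.prems(1) that] Ck_open_Suc_has_derivative[OF Suc.prems(2) that]
      by (rule has_derivative_add)
  qed (use assms(1) Suc in simp_all)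
qed

lemma Ck_open_scaleR:
  fixes g :: "'a::euclidean_space \<Rightarrow> 'b::euclidean_space"
  assumes "open U" "Ck_open k U f" "Ck_open k U g"
  shows "Ck_open k U (\<lambda>x. f x *\<^sub>R g x)"
  using assms(2,3)
proof (induction k arbitrary: f g)
  case 0
  then show ?case by (simp add: continuous_on_scaleR)
next
  case (Suc k)
  show ?case
  proof (rule Ck_open_SucI[where f' = "\<lambda>x v. f x *\<^sub>R frechet_derivative g (at x) v + frechet_derivative f (at x) v *\<^sub>R g x"])
    show "((\<lambda>x. f x *\<^sub>R g x) has_derivative (\<lambda>v. f x *\<^sub>R frechet_derivative g (at x) v + frechet_derivative f (at x) v *\<^sub>R g x)) (at x)"
      if "x \<in> U" for x
      using Ck_open_Suc_has_derivative[OF Suc.prems(1) that] Ck_open_Suc_has_derivative[OF Suc.prems(2) that]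
      by (rule has_derivative_scaleR)
    show "Ck_open k U (\<lambda>x. f x *\<^sub>R frechet_derivative g (at x) v + frechet_derivative f (at x) v *\<^sub>R g x)" for v
      using Suc.prems Ck_open_SucD[of k U f] Ck_open_SucD[of k U g]
      by (intro Ck_open_add assms(1) Suc.IH) auto
  qed (fact assms(1))
qed

lemma Ck_open_mult:
  fixes f g :: "'a::euclidean_space \<Rightarrow> real"
  assumes "open U" "Ck_open k U f" "Ck_open k U g"
  shows "Ck_open k U (\<lambda>x. f x * g x)"
  using Ck_open_scaleR[OF assms] by simp

lemma Ck_open_minus:
  assumes "open U" "Ck_open k U f"
  shows "Ck_open k U (\<lambda>x. - f x)"
  using Ck_open_scaleR[OF assms(1) Ck_open_const[OF assms(1)] assms(2), of "-1"] by simp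

lemma Ck_open_diff:
  assumes "open U" "Ck_open k U f" "Ck_open k U g"
  shows "Ck_open k U (\<lambda>x. f x - g x)"
  using Ck_open_add[OF assms(1,2) Ck_open_minus[OF assms(1,3)]] by simp

lemma Ck_open_sum:
  assumes "open U" "\<And>i. i \<in> I \<Longrightarrow> Ck_open k U (f i)"
  shows "Ck_open k U (\<lambda>x. \<Sum>i\<in>I. f i x)"
  using assms(2)
  by (induction I rule: infinite_finite_induct) (auto intro!: Ck_open_const Ck_open_add assms(1))

lemma Ck_open_prod:
  fixes f :: "'i \<Rightarrow> 'a::euclidean_space \<Rightarrow> real"
  assumes "open U" "\<And>i. i \<in> I \<Longrightarrow> Ck_open k U (f i)"
  shows "Ck_open k U (\<lambda>x. \<Prod>i\<in>I. f i x)"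
  using assms(2)
  by (induction I rule: infinite_finite_induct) (auto intro!: Ck_open_const Ck_open_mult assms(1))

lemma Ck_open_inverse:
  fixes f :: "'a::euclidean_space \<Rightarrow> real"
  assumes "open U" "\<And>x. x \<in> U \<Longrightarrow> f x \<noteq> 0" "Ck_open k U f"
  shows "Ck_open k U (\<lambda>x. inverse (f x))"
  using assms(3)
proof (induction k)
  case 0
  then show ?case using assms(2) by (simp add: continuous_on_inverse)
next
  case (Suc k)
  have *: "Ck_open k U (\<lambda>x. inverse (f x))" using Suc Ck_open_SucD by blast
  show ?case
  proof (rule Ck_open_SucI[where f' = "\<lambda>x v. - (inverse (f x) * frechet_derivative f (at x) v * inverse (f x))"])
    show "((\<lambda>x. inverse (f x)) has_derivative (\<lambda>v. - (inverse (f x) * frechet_derivative f (at x) v * inverse (f x)))) (at x)"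
      if "x \<in> U" for x
      using assms(2) that Ck_open_Suc_has_derivative[OF Suc.prems that]
      by (intro Deriv.has_derivative_inverse) auto
    show "Ck_open k U (\<lambda>x. - (inverse (f x) * frechet_derivative f (at x) v * inverse (f x)))" for v
      using Suc.prems * by (intro Ck_open_minus Ck_open_mult assms(1)) auto
  qed (fact assms(1))
qed

text \<open>In the chain rule the derivative of \<open>g\<close> is applied to a vector that moves
  with \<open>x\<close>, while the definition only speaks of fixed directions. Expanding that vector
  in the basis leaves directional derivatives of \<open>g\<close> along fixed \<open>b\<close>, to
  which the induction hypothesis applies.\<close>

lemma Ck_open_compose:
  fixes f :: "'a::euclidean_space \<Rightarrow> 'b::euclidean_space" and g :: "'b \<Rightarrow> 'c::euclidean_space"
  assumes "open U" "open V" "f ` U \<subseteq> V" "Ck_open k U f" "Ck_open k V g"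
  shows "Ck_open k U (\<lambda>x. g (f x))"
  using assms(4,5)
proof (induction k arbitrary: g)
  case 0
  then show ?case
    using continuous_on_compose2[of V g U f] assms(3) by simp
next
  case (Suc k)
  have expand: "frechet_derivative g (at (f x)) (frechet_derivative f (at x) v) =
      (\<Sum>b\<in>Basis. (frechet_derivative f (at x) v \<bullet> b) *\<^sub>R frechet_derivative g (at (f x)) b)"
    if "x \<in> U" for x v
  proof -
    have "f x \<in> V" using that assms(3) by auto
    then have "linear (frechet_derivative g (at (f x)))"
      using Suc.prems(2) by (intro linear_frechet_derivative) auto
    then show ?thesis by (rule linear_eq_sum_Basis)
  qed
  show ?case
  proof (rule Ck_open_SucI[where f' = "\<lambda>x v. frechet_derivative g (at (f x)) (frechet_derivative f (at x) v)"])
    show "((\<lambda>x. g (f x)) has_derivative (\<lambda>v. frechet_derivative g (at (f x)) (frechet_derivative f (at x) v))) (at x)"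
      if "x \<in> U" for x
      using that assms(3)
      by (intro has_derivative_compose[OF Ck_open_Suc_has_derivative[OF Suc.prems(1)]]
          Ck_open_Suc_has_derivative[OF Suc.prems(2)]) auto
    have inner: "Ck_open k U (\<lambda>x. frechet_derivative f (at x) v \<bullet> b)" for v b
    proof -
      have "Ck_open k U (\<lambda>x. frechet_derivative f (at x) v)" using Suc.prems by auto
      \<comment> \<open>Composition with a linear functional is an instance of the lemma being
        proved, so coordinates get their own induction.\<close>
      moreover have "Ck_open j U F \<Longrightarrow> Ck_open j U (\<lambda>x. F x \<bullet> b)" for j and F :: "'a \<Rightarrow> 'b"
      proof (induction j arbitrary: F)
        case 0
        then show ?case by (simp add: continuous_on_inner)
      next
        case (Suc j)
        show ?case
        proof (rule Ck_open_SucI[where f' = "\<lambda>x v. frechet_derivative F (at x) v \<bullet> b"])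
          show "((\<lambda>x. F x \<bullet> b) has_derivative (\<lambda>v. frechet_derivative F (at x) v \<bullet> b)) (at x)"
            if "x \<in> U" for x
            using Ck_open_Suc_has_derivative[OF Suc.prems that] by (rule has_derivative_inner_left)
        qed (use assms(1) Suc in simp_all)
      qed
      ultimately show ?thesis by blast
    qed
    show "Ck_open k U (\<lambda>x. frechet_derivative g (at (f x)) (frechet_derivative f (at x) v))" for v
    proof -
      have "Ck_open k U (\<lambda>x. frechet_derivative g (at (f x)) b)" for b
        using Suc.prems Ck_open_SucD[OF Suc.prems(1)]
        by (intro Suc.IH[of "\<lambda>z. frechet_derivative g (at z) b"]) auto
      then have "Ck_open k U (\<lambda>x. \<Sum>b\<in>Basis. (frechet_derivative f (at x) v \<bullet> b) *\<^sub>R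
          frechet_derivative g (at (f x)) b)"
        by (intro Ck_open_sum Ck_open_scaleR assms(1) inner)
      moreover have "Ck_open k U (\<lambda>x. frechet_derivative g (at (f x)) (frechet_derivative f (at x) v)) \<longleftrightarrow>
          Ck_open k U (\<lambda>x. \<Sum>b\<in>Basis. (frechet_derivative f (at x) v \<bullet> b) *\<^sub>R
            frechet_derivative g (at (f x)) b)"
        by (rule Ck_open_cong[OF assms(1)]) (rule expand)
      ultimately show ?thesis by simp
    qed
  qed (fact assms(1))
qed

section \<open>Smoothness on arbitrary sets through local extensions\<close>

lemma smooth_onE:
  assumes "smooth_on S f" "p \<in> S"
  obtains U F where "open U" "p \<in> U" "\<And>k. Ck_open k U F" "\<And>z. z \<in> U \<Longrightarrow> z \<in> S \<Longrightarrow> F z = f z"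
proof -
  have "\<exists>U F. open U \<and> p \<in> U \<and> (\<forall>k. Ck_open k U F) \<and> (\<forall>z\<in>U \<inter> S. F z = f z)"
    using assms unfolding smooth_on_def by (rule bspec)
  then obtain U F where "open U" "p \<in> U" "\<forall>k. Ck_open k U F" "\<forall>z\<in>U \<inter> S. F z = f z"
    by blast
  then show thesis by (intro that[of U F]) auto
qed

lemma smooth_onI:
  assumes "\<And>p. p \<in> S \<Longrightarrow>
    \<exists>U F. open U \<and> p \<in> U \<and> (\<forall>k. Ck_open k U F) \<and> (\<forall>z\<in>U \<inter> S. F z = f z)"
  shows "smooth_on S f"
  using assms unfolding smooth_on_def by (rule ballI)

text \<open>On the whole space a local extension is the function itself, so ambient maps can be
  handled by the recursive predicate alone.\<close>

lemma smooth_on_UNIV_iff: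
  "smooth_on UNIV f \<longleftrightarrow> (\<forall>k. Ck_open k UNIV f)"
proof
  assume L: "smooth_on UNIV f"
  show "\<forall>k. Ck_open k UNIV f"
  proof (intro allI Ck_open_locally)
    fix k x
    obtain U F where U: "open U" "x \<in> U" "\<And>k. Ck_open k U F" "\<And>z. z \<in> U \<Longrightarrow> F z = f z"
      using L by (rule smooth_onE) auto
    then have "Ck_open k U f" using Ck_open_cong[of U F f k] by simp
    then show "\<exists>N. open N \<and> x \<in> N \<and> Ck_open k N f" using U by blast
  qed
next
  assume "\<forall>k. Ck_open k UNIV f"
  then show "smooth_on UNIV f"
    by (intro smooth_onI exI[of _ UNIV] exI[of _ f]) auto
qed

lemma smooth_on_subset:
  assumes "smooth_on T f" "S \<subseteq> T"
  shows "smooth_on S f"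
proof (rule smooth_onI)
  fix p assume "p \<in> S"
  then have "p \<in> T" using assms(2) by blast
  with assms(1) obtain U F where "open U" "p \<in> U" "\<And>k. Ck_open k U F" "\<And>z. z \<in> U \<Longrightarrow> z \<in> T \<Longrightarrow> F z = f z"
    by (rule smooth_onE) (rule that)
  then show "\<exists>U F. open U \<and> p \<in> U \<and> (\<forall>k. Ck_open k U F) \<and> (\<forall>z\<in>U \<inter> S. F z = f z)"
    using assms(2) by (intro exI[of _ U] exI[of _ F]) auto
qed

lemma smooth_on_cong: "(\<And>x. x \<in> S \<Longrightarrow> f x = g x) \<Longrightarrow> smooth_on S f \<longleftrightarrow> smooth_on S g"
  unfolding smooth_on_def by simp

lemma smooth_on_compose:
  assumes f: "smooth_on S f" and g: "smooth_on T g" and "f ` S \<subseteq> T"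
  shows "smooth_on S (\<lambda>x. g (f x))"
proof (rule smooth_onI)
  fix p assume p: "p \<in> S"
  obtain U F where U: "open U" "p \<in> U" "\<And>k. Ck_open k U F" "\<And>z. z \<in> U \<Longrightarrow> z \<in> S \<Longrightarrow> F z = f z"
    using f p by (rule smooth_onE) (rule that)
  have "f p \<in> T" using p assms(3) by auto
  obtain V G where V: "open V" "f p \<in> V" "\<And>k. Ck_open k V G" "\<And>z. z \<in> V \<Longrightarrow> z \<in> T \<Longrightarrow> G z = g z"
    using g \<open>f p \<in> T\<close> by (rule smooth_onE) (rule that)
  \<comment> \<open>The extension \<open>F\<close> need not map \<open>U\<close> into
    \<open>V\<close>, so the composite extension is taken on the preimage only.\<close>
  have "continuous_on U F" using U(3)[of 0] by simp
  then have op: "open (U \<inter> F -` V)" using U(1) V(1) by (simp add: continuous_open_preimage)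
  show "\<exists>U H. open U \<and> p \<in> U \<and> (\<forall>k. Ck_open k U H) \<and> (\<forall>z\<in>U \<inter> S. H z = g (f z))"
  proof (intro exI conjI allI ballI)
    show "open (U \<inter> F -` V)" by fact
    show "p \<in> U \<inter> F -` V" using U V p by auto
    show "Ck_open k (U \<inter> F -` V) (\<lambda>x. G (F x))" for k
      using op V(1) _ Ck_open_subset[OF U(3)] V(3) by (rule Ck_open_compose) auto
    show "G (F z) = g (f z)" if "z \<in> U \<inter> F -` V \<inter> S" for z
      using that U(4)[of z] V(4)[of "f z"] assms(3) by auto
  qed
qed

section \<open>Bump functions and derivative bounds\<close>

lemma smooth_on_UNIV_has_derivative:
  "smooth_on UNIV f \<Longrightarrow> (f has_derivative frechet_derivative f (at x)) (at x)"
  unfolding smooth_on_UNIV_iff using Ck_open_Suc_has_derivative[of 0 UNIV f x] by blast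

lemma smooth_on_UNIV_frechet_derivative:
  "smooth_on UNIV f \<Longrightarrow> smooth_on UNIV (\<lambda>x. frechet_derivative f (at x) v)"
  unfolding smooth_on_UNIV_iff using Ck_open.simps(2)[of _ UNIV f] by blast

lemma smooth_on_UNIV_continuous: "smooth_on UNIV f \<Longrightarrow> continuous_on S f"
  unfolding smooth_on_UNIV_iff using Ck_open.simps(1)[of UNIV f] continuous_on_subset by blast

lemma smooth_on_UNIV_intros:
  fixes f g :: "'a::euclidean_space \<Rightarrow> 'b::euclidean_space" and r s :: "'a \<Rightarrow> real"
  shows smooth_on_const: "smooth_on UNIV (\<lambda>x::'a. c :: 'b)"
    and smooth_on_ident: "smooth_on UNIV (\<lambda>x::'a. x)"
    and smooth_on_add: "smooth_on UNIV f \<Longrightarrow> smooth_on UNIV g \<Longrightarrow> smooth_on UNIV (\<lambda>x. f x + g x)"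
    and smooth_on_diff: "smooth_on UNIV f \<Longrightarrow> smooth_on UNIV g \<Longrightarrow> smooth_on UNIV (\<lambda>x. f x - g x)"
    and smooth_on_scaleR: "smooth_on UNIV r \<Longrightarrow> smooth_on UNIV f \<Longrightarrow> smooth_on UNIV (\<lambda>x. r x *\<^sub>R f x)"
    and smooth_on_mult: "smooth_on UNIV r \<Longrightarrow> smooth_on UNIV s \<Longrightarrow> smooth_on UNIV (\<lambda>x. r x * s x)"
  by (simp_all add: smooth_on_UNIV_iff Ck_open_const Ck_open_add Ck_open_diff Ck_open_scaleR
      Ck_open_mult Ck_open_bounded_linear bounded_linear_ident)

lemma smooth_on_sum:
  "(\<And>i. i \<in> I \<Longrightarrow> smooth_on UNIV (f i)) \<Longrightarrow> smooth_on UNIV (\<lambda>x. \<Sum>i\<in>I. f i x)"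
  by (simp add: smooth_on_UNIV_iff Ck_open_sum)

lemma smooth_on_bounded_linear: "bounded_linear f \<Longrightarrow> smooth_on UNIV f"
  by (simp add: smooth_on_UNIV_iff Ck_open_bounded_linear)

lemma smooth_on_UNIV_compose:
  "smooth_on UNIV g \<Longrightarrow> smooth_on UNIV f \<Longrightarrow> smooth_on UNIV (\<lambda>x. g (f x))"
  by (rule smooth_on_compose[of UNIV f UNIV g]) auto

text \<open>For \<open>n = 0\<close> this is the classical flat function
  \<open>exp (- 1 / x)\<close>, extended by 0. The powers of \<open>inverse x\<close> are the
  factors that its derivatives produce.\<close>

definition flat_exp :: "nat \<Rightarrow> real \<Rightarrow> real" where
  "flat_exp n x = (if x \<le> 0 then 0 else exp (- inverse x) * inverse x ^ n)"

lemma flat_exp_tendsto_0: "(flat_exp n \<longlongrightarrow> 0) (at 0)"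
proof -
  have "((\<lambda>x. inverse x ^ n / exp (inverse x)) \<longlongrightarrow> (0::real)) (at_right 0)"
    using tendsto_power_div_exp_0 filterlim_inverse_at_top_right by (rule filterlim_compose)
  then have R: "(flat_exp n \<longlongrightarrow> 0) (at_right 0)"
    by (rule Lim_transform_eventually)
      (auto simp: eventually_at_filter flat_exp_def exp_minus field_simps)
  have L: "(flat_exp n \<longlongrightarrow> 0) (at_left 0)"
    by (rule Lim_transform_eventually[OF tendsto_const])
      (auto simp: eventually_at_filter flat_exp_def)
  show ?thesis using L R filterlim_split_at by blast
qed

text \<open>The family is closed under differentiation, which gives smoothness of all its members at once.\<close>

lemma flat_exp_has_derivative:
  "(flat_exp n has_real_derivative flat_exp (n + 2) x - real n * flat_exp (n + 1) x) (at x)"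
proof -
  consider "x < 0" | "x = 0" | "x > 0" by linarith
  then show ?thesis
  proof cases
    case 1
    have "((\<lambda>_. 0) has_real_derivative 0) (at x)" by simp
    then have "(flat_exp n has_real_derivative 0) (at x)"
      by (rule has_field_derivative_transform_within_open[where S = "{..<0}"])
        (use 1 in \<open>auto simp: flat_exp_def\<close>)
    then show ?thesis using 1 by (simp add: flat_exp_def)
  next
    case 2
    \<comment> \<open>Off 0 the difference quotient at 0 is the next member of the family, whose
      limit is already known.\<close>
    have "((\<lambda>y. (flat_exp n y - flat_exp n 0) / (y - 0)) \<longlongrightarrow> 0) (at 0)"
      by (rule Lim_transform_eventually[OF flat_exp_tendsto_0[of "n + 1"]])
        (auto simp: eventually_at_filter flat_exp_def field_simps)
    then show ?thesis unfolding 2 has_field_derivative_iff by (simp add: flat_exp_def)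
  next
    case 3
    have "((\<lambda>x. exp (- inverse x) * inverse x ^ n) has_real_derivative
        exp (- inverse x) * inverse x ^ (n + 2) - real n * (exp (- inverse x) * inverse x ^ (n + 1))) (at x)"
    proof (cases n)
      case 0
      then show ?thesis using 3
        by (auto intro!: derivative_eq_intros simp: power2_eq_square)
    next
      case (Suc m)
      show ?thesis unfolding Suc using 3
        by (auto intro!: derivative_eq_intros simp: power2_eq_square algebra_simps simp del: power_Suc)
          (simp add: algebra_simps)
    qed
    then have "(flat_exp n has_real_derivative
        exp (- inverse x) * inverse x ^ (n + 2) - real n * (exp (- inverse x) * inverse x ^ (n + 1))) (at x)"
      by (rule has_field_derivative_transform_within_open[where S = "{0<..}"])
        (use 3 in \<open>auto simp: flat_exp_def\<close>)
    then show ?thesis using 3 by (simp add: flat_exp_def)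
  qed
qed

lemma smooth_flat_exp: "smooth_on UNIV (flat_exp n)"
  unfolding smooth_on_UNIV_iff
proof
  show "Ck_open k UNIV (flat_exp n)" for k
  proof (induction k arbitrary: n)
    case 0
    show ?case
      unfolding Ck_open.simps
      by (rule DERIV_continuous_on, rule has_field_derivative_at_within, rule flat_exp_has_derivative)
  next
    case (Suc k)
    show ?case
    proof (rule Ck_open_SucI[where f' = "\<lambda>x v. (flat_exp (n + 2) x - real n * flat_exp (n + 1) x) * v"])
      show "(flat_exp n has_derivative (\<lambda>v. (flat_exp (n + 2) x - real n * flat_exp (n + 1) x) * v)) (at x)" for x
        using flat_exp_has_derivative[of n x] by (simp add: has_field_derivative_def)
      show "Ck_open k UNIV (\<lambda>x. (flat_exp (n + 2) x - real n * flat_exp (n + 1) x) * v)" for v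
        by (intro Ck_open_mult Ck_open_diff Ck_open_const Suc.IH) auto
    qed simp
  qed
qed

lemma unit_bump_exists:
  obtains \<beta> :: "'a::euclidean_space \<Rightarrow> real"
  where "smooth_on UNIV \<beta>" "\<And>y. 0 \<le> \<beta> y" "\<And>y. \<beta> y \<le> 1"
    "\<And>y. norm y \<le> 1 \<Longrightarrow> \<beta> y = 1" "\<And>y. norm y \<ge> 2 \<Longrightarrow> \<beta> y = 0"
proof
  define g where "g = flat_exp 0"
  \<comment> \<open>The square \<open>y \<bullet> y\<close> is used since the norm is not smooth at
    0. The two arguments of \<open>g\<close> in the denominator add up to 3, so at least one is
    positive and the denominator never vanishes; the numerator dies at radius 2, the other summand
    inside radius 1.\<close>
  define \<beta> where "\<beta> y = g (4 - y \<bullet> y) * inverse (g (4 - y \<bullet> y) + g (y \<bullet> y - 1))" for y :: 'a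
  have g0: "g t \<ge> 0" for t by (simp add: g_def flat_exp_def)
  have gpos: "g t > 0" if "t > 0" for t using that by (simp add: g_def flat_exp_def)
  have gz: "g t = 0" if "t \<le> 0" for t using that by (simp add: g_def flat_exp_def)
  have pos: "g (4 - y \<bullet> y) + g (y \<bullet> y - 1) > 0" for y :: 'a
    using gpos[of "4 - y \<bullet> y"] gpos[of "y \<bullet> y - 1"] g0[of "4 - y \<bullet> y"] g0[of "y \<bullet> y - 1"] by linarith
  have sq: "smooth_on UNIV (\<lambda>y::'a. y \<bullet> y)"
  proof -
    have "smooth_on UNIV (\<lambda>y::'a. \<Sum>b\<in>Basis. (y \<bullet> b) * (y \<bullet> b))"
      by (intro smooth_on_sum smooth_on_mult smooth_on_bounded_linear bounded_linear_inner_left)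
    then show ?thesis by (simp add: euclidean_inner[symmetric])
  qed
  have sg: "smooth_on UNIV g" unfolding g_def by (rule smooth_flat_exp)
  have num: "smooth_on UNIV (\<lambda>y::'a. g (4 - y \<bullet> y))" "smooth_on UNIV (\<lambda>y::'a. g (y \<bullet> y - 1))"
    by (rule smooth_on_UNIV_compose[OF sg], intro smooth_on_UNIV_intros sq)+
  have "smooth_on UNIV (\<lambda>y::'a. inverse (g (4 - y \<bullet> y) + g (y \<bullet> y - 1)))"
    unfolding smooth_on_UNIV_iff
    using pos by (intro allI Ck_open_inverse Ck_open_add num[unfolded smooth_on_UNIV_iff, rule_format]
        open_UNIV) (metis less_irrefl)
  then show "smooth_on UNIV \<beta>" unfolding \<beta>_def by (intro smooth_on_mult num)
  show "0 \<le> \<beta> y" for y using g0 pos[of y] by (simp add: \<beta>_def)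
  show "\<beta> y \<le> 1" for y using g0 pos[of y] by (simp add: \<beta>_def field_simps)
  show "\<beta> y = 1" if "norm y \<le> 1" for y
  proof -
    have "y \<bullet> y \<le> 1" using that by (simp add: dot_square_norm power_le_one)
    then show ?thesis using gz[of "y \<bullet> y - 1"] pos[of y] by (simp add: \<beta>_def)
  qed
  show "\<beta> y = 0" if "norm y \<ge> 2" for y
  proof -
    have "y \<bullet> y \<ge> 2\<^sup>2" unfolding dot_square_norm using that by (intro power_mono) auto
    then show ?thesis using gz[of "4 - y \<bullet> y"] by (simp add: \<beta>_def)
  qed
qed

lemma smooth_derivative_bounded_on_compact:
  fixes f :: "'a::euclidean_space \<Rightarrow> 'b::euclidean_space"
  assumes "smooth_on UNIV f" "compact K"
  obtains M where "M \<ge> 0" "\<And>y v. y \<in> K \<Longrightarrow> norm (frechet_derivative f (at y) v) \<le> M * norm v"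
proof -
  let ?D = "\<lambda>y. frechet_derivative f (at y)"
  have "continuous_on K (\<lambda>y. \<Sum>b\<in>Basis. norm (?D y b))"
    by (intro continuous_on_sum continuous_on_norm smooth_on_UNIV_continuous
        smooth_on_UNIV_frechet_derivative assms(1))
  then have "bounded ((\<lambda>y. \<Sum>b\<in>Basis. norm (?D y b)) ` K)"
    using assms(2) by (intro compact_imp_bounded compact_continuous_image)
  then obtain M where "M > 0" "\<forall>t\<in>(\<lambda>y. \<Sum>b\<in>Basis. norm (?D y b)) ` K. norm t \<le> M"
    unfolding bounded_pos by blast
  then have M: "M \<ge> 0" "\<And>y. y \<in> K \<Longrightarrow> (\<Sum>b\<in>Basis. norm (?D y b)) \<le> M" by auto
  show thesis
  proof (rule that[OF M(1)])
    fix y v :: 'a assume y: "y \<in> K"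
    have lin: "linear (?D y)"
      using smooth_on_UNIV_has_derivative[OF assms(1)] by (rule has_derivative_linear)
    have "(\<Sum>b\<in>Basis. norm (?D y b)) * norm v \<le> M * norm v"
      using M(2)[OF y] by (rule mult_right_mono) simp
    then show "norm (?D y v) \<le> M * norm v" using norm_linear_le_Basis[OF lin, of v] by linarith
  qed
qed

lemma frechet_derivative_zero_off_support:
  fixes f :: "'a::euclidean_space \<Rightarrow> 'b::euclidean_space"
  assumes "closed K" "\<And>y. y \<notin> K \<Longrightarrow> f y = 0" "y \<notin> K"
  shows "frechet_derivative f (at y) v = 0"
proof -
  have "frechet_derivative f (at y) = frechet_derivative (\<lambda>_. 0) (at y)"
    using assms by (intro frechet_derivative_cong_open[of "- K"]) auto
  then show ?thesis by simp
qed

text \<open>One profile is rescaled, so a single \<open>C\<close> serves all centres and radii. The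
  growth \<open>C / a\<close> is harmless when the function to be cut off has size of order
  \<open>a\<close> times a small number.\<close>

lemma bump_exists:
  obtains C :: real where "C \<ge> 0"
    "\<And>(p :: 'a::euclidean_space) a. a > 0 \<Longrightarrow> \<exists>\<beta>. smooth_on UNIV \<beta> \<and> (\<forall>y. 0 \<le> \<beta> y \<and> \<beta> y \<le> 1) \<and>
       (\<forall>y\<in>cball p a. \<beta> y = 1) \<and> (\<forall>y. y \<notin> ball p (2 * a) \<longrightarrow> \<beta> y = 0) \<and>
       (\<forall>y v. \<bar>frechet_derivative \<beta> (at y) v\<bar> \<le> C / a * norm v)"
proof -
  obtain \<beta> :: "'a \<Rightarrow> real" where \<beta>: "smooth_on UNIV \<beta>" "\<And>y. 0 \<le> \<beta> y" "\<And>y. \<beta> y \<le> 1"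
    "\<And>y. norm y \<le> 1 \<Longrightarrow> \<beta> y = 1" "\<And>y. norm y \<ge> 2 \<Longrightarrow> \<beta> y = 0"
    by (rule unit_bump_exists) (rule that)
  obtain C where C: "C \<ge> 0"
    "\<And>y v. y \<in> cball 0 2 \<Longrightarrow> norm (frechet_derivative \<beta> (at y) v) \<le> C * norm v"
    by (rule smooth_derivative_bounded_on_compact[OF \<beta>(1) compact_cball, of 0 2]) (rule that)
  have C': "\<bar>frechet_derivative \<beta> (at y) v\<bar> \<le> C * norm v" for y v
  proof (cases "y \<in> cball 0 2")
    case True
    then show ?thesis using C(2)[of y v] by simp
  next
    case False
    then have "frechet_derivative \<beta> (at y) v = 0"
      by (intro frechet_derivative_zero_off_support[of "cball 0 2"]) (auto intro: \<beta>(5))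
    then show ?thesis using C(1) by simp
  qed
  show thesis
  proof
    show "C \<ge> 0" by fact
    fix p :: 'a and a :: real assume a: "a > 0"
    define \<psi> where "\<psi> y = \<beta> ((1 / a) *\<^sub>R (y - p))" for y
    have s: "smooth_on UNIV \<psi>" unfolding \<psi>_def
      by (rule smooth_on_UNIV_compose[OF \<beta>(1)]) (intro smooth_on_UNIV_intros)
    have n: "norm ((1 / a) *\<^sub>R (y - p)) = dist p y / a" for y
      using a by (simp add: dist_norm norm_minus_commute)
    have d: "frechet_derivative \<psi> (at y) v = frechet_derivative \<beta> (at ((1 / a) *\<^sub>R (y - p))) ((1 / a) *\<^sub>R v)" for y v
    proof -
      have "((\<lambda>y. (1 / a) *\<^sub>R (y - p)) has_derivative (\<lambda>v. (1 / a) *\<^sub>R v)) (at y)"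
        by (auto intro!: derivative_eq_intros)
      from has_derivative_compose[OF this smooth_on_UNIV_has_derivative[OF \<beta>(1)]]
      show ?thesis unfolding \<psi>_def[abs_def] by (simp add: frechet_derivative_at[symmetric])
    qed
    show "\<exists>\<beta>. smooth_on UNIV \<beta> \<and> (\<forall>y. 0 \<le> \<beta> y \<and> \<beta> y \<le> 1) \<and>
       (\<forall>y\<in>cball p a. \<beta> y = 1) \<and> (\<forall>y. y \<notin> ball p (2 * a) \<longrightarrow> \<beta> y = 0) \<and>
       (\<forall>y v. \<bar>frechet_derivative \<beta> (at y) v\<bar> \<le> C / a * norm v)"
    proof (intro exI[of _ \<psi>] conjI allI ballI impI s)
      show "0 \<le> \<psi> y" "\<psi> y \<le> 1" for y using \<beta> by (auto simp: \<psi>_def)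
      show "\<psi> y = 1" if "y \<in> cball p a" for y
        unfolding \<psi>_def using that a by (intro \<beta>(4)) (simp only: n, simp)
      show "\<psi> y = 0" if "y \<notin> ball p (2 * a)" for y
        unfolding \<psi>_def using that a by (intro \<beta>(5)) (simp only: n, simp add: field_simps)
      show "\<bar>frechet_derivative \<psi> (at y) v\<bar> \<le> C / a * norm v" for y v
        unfolding d using C'[of "(1 / a) *\<^sub>R (y - p)" "(1 / a) *\<^sub>R v"] a by simp
    qed
  qed
qed

text \<open>Only the derivative is bounded, not the function itself.\<close>

definition derivative_bound :: "real \<Rightarrow> ('a::euclidean_space \<Rightarrow> 'b::euclidean_space) \<Rightarrow> bool" where
  "derivative_bound c f \<longleftrightarrow> smooth_on UNIV f \<and> (\<forall>y v. norm (frechet_derivative f (at y) v) \<le> c * norm v)"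

lemma derivative_bound_mono:
  assumes "derivative_bound c f" "c \<le> d"
  shows "derivative_bound d f"
proof -
  have "c * norm v \<le> d * norm v" for v :: 'a using assms(2) by (simp add: mult_right_mono)
  then show ?thesis using assms(1) order_trans unfolding derivative_bound_def by blast
qed

lemma derivative_bound_add:
  assumes "derivative_bound c f" "derivative_bound d g"
  shows "derivative_bound (c + d) (\<lambda>y. f y + g y)"
proof -
  have "frechet_derivative (\<lambda>y. f y + g y) (at y) v = frechet_derivative f (at y) v + frechet_derivative g (at y) v" for y v
  proof -
    have "((\<lambda>y. f y + g y) has_derivative (\<lambda>v. frechet_derivative f (at y) v + frechet_derivative g (at y) v)) (at y)"
      using assms by (intro has_derivative_add smooth_on_UNIV_has_derivative) (simp_all add: derivative_bound_def)
    then show ?thesis by (simp add: frechet_derivative_at[symmetric])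
  qed
  moreover have "norm (frechet_derivative f (at y) v + frechet_derivative g (at y) v) \<le> (c + d) * norm v" for y v
    unfolding distrib_right
    using assms by (intro norm_triangle_le add_mono) (simp_all add: derivative_bound_def)
  ultimately show ?thesis using assms by (simp add: derivative_bound_def smooth_on_add)
qed

lemma derivative_bound_sum:
  assumes "\<And>i. i \<in> I \<Longrightarrow> derivative_bound (c i) (f i)"
  shows "derivative_bound (\<Sum>i\<in>I. c i) (\<lambda>y. \<Sum>i\<in>I. f i y)"
proof -
  have "derivative_bound 0 (\<lambda>y. 0)" by (simp add: derivative_bound_def smooth_on_const)
  then show ?thesis using assms
    by (induction I rule: infinite_finite_induct) (auto intro!: derivative_bound_add)
qed

text \<open>The product rule gives the estimate on \<open>K\<close>. Off \<open>K\<close> both the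
  cutoff and its derivative vanish, because the complement is open; hence estimates on
  \<open>K\<close> suffice for a global bound.\<close>

lemma derivative_bound_cutoff:
  fixes \<tau> :: "'a::euclidean_space \<Rightarrow> real" and f :: "'a \<Rightarrow> 'b::euclidean_space"
  assumes "smooth_on UNIV \<tau>" "smooth_on UNIV f" "closed K" "\<And>y. y \<notin> K \<Longrightarrow> \<tau> y = 0"
    and "A \<ge> 0" "B \<ge> 0" "c \<ge> 0" "d \<ge> 0"
    and "\<And>y. y \<in> K \<Longrightarrow> \<bar>\<tau> y\<bar> \<le> A" "\<And>y v. y \<in> K \<Longrightarrow> \<bar>frechet_derivative \<tau> (at y) v\<bar> \<le> B * norm v"
    and "\<And>y. y \<in> K \<Longrightarrow> norm (f y) \<le> c" "\<And>y v. y \<in> K \<Longrightarrow> norm (frechet_derivative f (at y) v) \<le> d * norm v"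
  shows "derivative_bound (A * d + B * c) (\<lambda>y. \<tau> y *\<^sub>R f y)"
  unfolding derivative_bound_def
proof (intro conjI allI)
  show "smooth_on UNIV (\<lambda>y. \<tau> y *\<^sub>R f y)" using assms by (intro smooth_on_scaleR)
  fix y v
  have eq: "frechet_derivative (\<lambda>y. \<tau> y *\<^sub>R f y) (at y) v =
      \<tau> y *\<^sub>R frechet_derivative f (at y) v + frechet_derivative \<tau> (at y) v *\<^sub>R f y"
    using has_derivative_scaleR[OF smooth_on_UNIV_has_derivative[OF assms(1), of y]
        smooth_on_UNIV_has_derivative[OF assms(2), of y]]
    by (simp add: frechet_derivative_at[symmetric])
  show "norm (frechet_derivative (\<lambda>y. \<tau> y *\<^sub>R f y) (at y) v) \<le> (A * d + B * c) * norm v"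
  proof (cases "y \<in> K")
    case True
    have "norm (\<tau> y *\<^sub>R frechet_derivative f (at y) v) \<le> A * (d * norm v)"
      using assms(5,8) assms(9)[OF True] assms(12)[OF True, of v] by (simp add: mult_mono)
    moreover have "norm (frechet_derivative \<tau> (at y) v *\<^sub>R f y) \<le> (B * norm v) * c"
      using assms(6,7) assms(10)[OF True, of v] assms(11)[OF True] by (simp add: mult_mono)
    ultimately show ?thesis unfolding eq
      by (intro order.trans[OF norm_triangle_ineq]) (simp add: algebra_simps)
  next
    case False
    then have "\<tau> y = 0" "frechet_derivative \<tau> (at y) v = 0"
      using assms frechet_derivative_zero_off_support[of K \<tau> y v] by auto
    then show ?thesis unfolding eq using assms(5-8) by simp
  qed
qed

lemma derivative_bound_lipschitz:
  assumes "derivative_bound c f"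
  shows "norm (f x - f y) \<le> c * norm (x - y)"
proof (rule differentiable_bound[OF convex_UNIV])
  show "(f has_derivative frechet_derivative f (at x)) (at x within UNIV)" for x
    using assms smooth_on_UNIV_has_derivative unfolding derivative_bound_def by auto
  show "onorm (frechet_derivative f (at x)) \<le> c" for x
    using assms by (intro onorm_le) (auto simp: derivative_bound_def)
qed auto

section \<open>Diffeomorphisms close to the identity\<close>

lemma Ck_open_vec_nth:
  fixes f :: "'a::euclidean_space \<Rightarrow> real^'m"
  assumes "open U" "Ck_open k U f"
  shows "Ck_open k U (\<lambda>x. f x $ i)"
  by (rule Ck_open_compose[OF assms(1) open_UNIV _ assms(2)])
    (simp_all add: Ck_open_bounded_linear bounded_linear_vec_nth)

lemma Ck_open_vecI:
  fixes f :: "'a::euclidean_space \<Rightarrow> real^'m"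
  assumes "open U" "\<And>i. Ck_open k U (\<lambda>x. f x $ i)"
  shows "Ck_open k U f"
proof -
  have "Ck_open k U (\<lambda>x. \<Sum>i\<in>UNIV. f x $ i *\<^sub>R (axis i 1 :: real^'m))"
    by (intro Ck_open_sum Ck_open_scaleR Ck_open_const assms)
  moreover have "(\<lambda>x. \<Sum>i\<in>UNIV. f x $ i *\<^sub>R (axis i 1 :: real^'m)) = f"
    by (rule ext) (simp only: scalar_mult_eq_scaleR[symmetric] basis_expansion)
  ultimately show ?thesis by simp
qed

lemma Ck_open_det:
  fixes A :: "'a::euclidean_space \<Rightarrow> real^'m^'m"
  assumes "open U" "\<And>i j. Ck_open k U (\<lambda>x. A x $ i $ j)"
  shows "Ck_open k U (\<lambda>x. det (A x))"
  unfolding det_def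
  by (intro Ck_open_sum Ck_open_mult Ck_open_prod Ck_open_const assms)

text \<open>Determinants are polynomials in the entries, so Cramer's formula expresses
  \<open>w\<close> by sums, products and one nonvanishing denominator of class
  \<open>Ck_open k\<close>; not even continuity of \<open>w\<close> is presupposed.\<close>

lemma Ck_open_linear_solution:
  fixes A :: "'a::euclidean_space \<Rightarrow> real^'m \<Rightarrow> real^'m" and w :: "'a \<Rightarrow> real^'m"
  assumes "open U" "\<And>x. x \<in> U \<Longrightarrow> linear (A x)" "\<And>x. x \<in> U \<Longrightarrow> inj (A x)"
    and "\<And>v. Ck_open k U (\<lambda>x. A x v)" "\<And>x. x \<in> U \<Longrightarrow> A x (w x) = v"
  shows "Ck_open k U w"
proof -
  define M where "M j x = (\<chi> i l. if l = j then v $ i else matrix (A x) $ i $ l)" for j x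
  define d where "d x = det (matrix (A x))" for x
  have entry: "Ck_open k U (\<lambda>x. matrix (A x) $ i $ l)" for i l
    using Ck_open_vec_nth[OF assms(1) assms(4), of "axis l 1" i] by (simp add: matrix_def)
  have d0: "d x \<noteq> 0" if "x \<in> U" for x
    using det_nz_iff_inj[OF assms(2)[OF that]] assms(3)[OF that] by (simp add: d_def)
  have "Ck_open k U (\<lambda>x. (if l = j then v $ i else matrix (A x) $ i $ l))" for i j l
    by (cases "l = j") (simp_all add: entry Ck_open_const assms(1))
  then have "Ck_open k U (\<lambda>x. det (M j x))" for j
    by (intro Ck_open_det assms(1)) (simp add: M_def)
  moreover have "Ck_open k U (\<lambda>x. inverse (d x))"
    unfolding d_def by (intro Ck_open_inverse Ck_open_det assms(1) entry d0[unfolded d_def])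
  ultimately have C: "Ck_open k U (\<lambda>x. det (M j x) * inverse (d x))" for j
    by (intro Ck_open_mult assms(1))
  have "w x $ j = det (M j x) * inverse (d x)" if "x \<in> U" for j x
  proof -
    have "matrix (A x) *v w x = v"
      using assms(5)[OF that] matrix_vector_mul(2)[OF assms(2)[OF that]] by metis
    then have "w x = (\<chi> j. det (M j x) / d x)"
      using cramer[of "matrix (A x)"] d0[OF that] unfolding M_def d_def by blast
    then show ?thesis by (simp add: divide_inverse)
  qed
  then have "Ck_open k U (\<lambda>x. w x $ j)" for j
    using C[of j] Ck_open_cong[OF assms(1), of "\<lambda>x. w x $ j" "\<lambda>x. det (M j x) * inverse (d x)"] by simp
  then show ?thesis by (intro Ck_open_vecI assms(1))
qed

text \<open>
  The derivative of the inverse solves a linear system whose coefficients are composed with the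
  inverse, so by Cramer's rule the inverse gains one order of differentiability at a time.
\<close>

lemma identity_plus_contraction_diffeo:
  fixes u :: "real^'m \<Rightarrow> real^'m"
  assumes u: "derivative_bound c u" and c: "0 \<le> c" "c < 1"
  obtains G where "smooth_on UNIV G" "\<And>y. G (y + u y) = y" "\<And>y. G y + u (G y) = y"
proof -
  have lip: "norm (u x - u y) \<le> c * norm (x - y)" for x y using derivative_bound_lipschitz[OF u] .
  \<comment> \<open>Solving \<open>x + u x = y\<close> is a fixed point problem for a contraction,
    so the inverse exists globally and not only near a point.\<close>
  have ex1: "\<exists>!x. y - u x = x" for y
    using lip by (intro banach_fix_type[OF c]) (simp add: dist_norm norm_minus_commute)
  define G where "G y = (THE x. y - u x = x)" for y
  have G: "y - u (G y) = G y" for y unfolding G_def by (rule theI'[OF ex1])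
  have uniq: "x = G y" if "y - u x = x" for x y using ex1[of y] G[of y] that by blast
  have right: "G y + u (G y) = y" for y using G[of y] by (simp add: algebra_simps)
  have left: "G (y + u y) = y" for y using uniq[of "y + u y" y] by simp
  \<comment> \<open>Continuity of \<open>G\<close> starts the induction on the order of
    differentiability, and it is also what turns the inverse of \<open>F (G y)\<close> into the
    derivative of \<open>G\<close>.\<close>
  have Glip: "norm (G y - G z) \<le> 1 / (1 - c) * norm (y - z)" for y z
  proof -
    have "G y - G z = (y - z) - (u (G y) - u (G z))" using G[of y] G[of z] by (simp add: algebra_simps)
    then have "norm (G y - G z) \<le> norm (y - z) + c * norm (G y - G z)"
      using norm_triangle_ineq4[of "y - z" "u (G y) - u (G z)"] lip[of "G y" "G z"] by simp
    then have "(1 - c) * norm (G y - G z) \<le> norm (y - z)" by (simp add: algebra_simps)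
    then show ?thesis using c by (simp add: pos_le_divide_eq mult.commute)
  qed
  have "(1 / (1 - c))-lipschitz_on UNIV G"
    using Glip c by (intro lipschitz_onI) (auto simp: dist_norm)
  then have contG: "continuous_on UNIV G" by (rule lipschitz_on_continuous_on)
  define F where "F x v = v + frechet_derivative u (at x) v" for x v
  have su: "smooth_on UNIV u" using u by (simp add: derivative_bound_def)
  have F: "((\<lambda>x. x + u x) has_derivative F x) (at x)" for x
    unfolding F_def by (intro has_derivative_add has_derivative_ident smooth_on_UNIV_has_derivative su)
  have linF: "linear (F x)" for x using F has_derivative_linear by blast
  have injF: "inj (F x)" for x
  proof (subst linear_injective_0[OF linF], intro allI impI)
    fix v assume "F x v = 0"
    then have "frechet_derivative u (at x) v = - v"
      unfolding F_def by (simp only: add_eq_0_iff)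
    then have "norm v = norm (frechet_derivative u (at x) v)" by simp
    also have "\<dots> \<le> c * norm v" using u by (simp add: derivative_bound_def)
    finally have "norm v \<le> c * norm v" .
    then have "(1 - c) * norm v \<le> 0" by (simp add: algebra_simps)
    then have "norm v \<le> 0" using c by (simp add: mult_le_0_iff)
    then show "v = 0" by simp
  qed
  have dG: "\<exists>g. (G has_derivative g) (at y) \<and> (\<forall>v. F (G y) (g v) = v)" for y
  proof -
    obtain g where g: "linear g" "\<And>v. g (F (G y) v) = v" "\<And>v. F (G y) (g v) = v"
      using linear_injective_isomorphism[OF linF injF, of "G y"] by blast
    have "(G has_derivative g) (at y)"
    proof (rule has_derivative_inverse_basic[OF F])
      show "bounded_linear g" using g(1) by (simp add: linear_conv_bounded_linear)
      show "g \<circ> F (G y) = id" using g(2) by (simp add: fun_eq_iff)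
      show "continuous (at y) G" using contG by (simp add: continuous_on_eq_continuous_at)
      show "G z + u (G z) = z" for z by (rule right)
    qed (rule open_UNIV, rule UNIV_I)
    then show ?thesis using g(3) by blast
  qed
  have "Ck_open k UNIV G" for k
  proof (induction k)
    case 0
    show ?case using contG by simp
  next
    case (Suc k)
    have 1: "(G has_derivative frechet_derivative G (at y)) (at y)"
      "F (G y) (frechet_derivative G (at y) v) = v" for y v
    proof -
      obtain g where g: "(G has_derivative g) (at y)" "\<forall>v. F (G y) (g v) = v" using dG by blast
      have "frechet_derivative G (at y) = g" using frechet_derivative_at[OF g(1)] by simp
      then show "(G has_derivative frechet_derivative G (at y)) (at y)"
        "F (G y) (frechet_derivative G (at y) v) = v" using g by simp_all
    qed
    have "Ck_open k UNIV (\<lambda>y. F (G y) v)" for v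
    proof -
      have "Ck_open k UNIV (\<lambda>x. F x v)"
        using smooth_on_UNIV_frechet_derivative[OF su, of v] unfolding F_def smooth_on_UNIV_iff
        by (intro Ck_open_add Ck_open_const) auto
      then show ?thesis
        by (rule Ck_open_compose[OF open_UNIV open_UNIV subset_UNIV Suc])
    qed
    then have "Ck_open k UNIV (\<lambda>y. frechet_derivative G (at y) v)" for v
      by (rule Ck_open_linear_solution[where A = "\<lambda>y. F (G y)", OF open_UNIV linF injF _ 1(2)])
    with 1(1) show ?case by (rule Ck_open_SucI[OF open_UNIV])
  qed
  then have "smooth_on UNIV G" by (simp add: smooth_on_UNIV_iff)
  then show thesis using left right by (rule that)
qed

section \<open>Ambient diffeomorphisms and stratifications\<close>

text \<open>The derivative is represented by a vector, found from its values on the basis.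
  Uniqueness of that vector shows that the description defining \<open>gradient\<close> denotes
  something for smooth functions.\<close>

lemma frechet_derivative_gradient:
  assumes "smooth_on UNIV f"
  shows "frechet_derivative f (at y) v = v \<bullet> gradient f y"
proof -
  let ?D = "frechet_derivative f (at y)"
  have D: "(f has_derivative ?D) (at y)" by (rule smooth_on_UNIV_has_derivative[OF assms])
  then have lin: "linear ?D" by (rule has_derivative_linear)
  define g where "g = (\<Sum>b\<in>Basis. ?D b *\<^sub>R b)"
  have g: "?D v = v \<bullet> g" for v
  proof -
    have "?D v = (\<Sum>b\<in>Basis. (v \<bullet> b) *\<^sub>R ?D b)" by (rule linear_eq_sum_Basis[OF lin])
    also have "\<dots> = v \<bullet> g" by (simp add: g_def inner_sum_right mult.commute)
    finally show ?thesis .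
  qed
  have G: "GDERIV f y :> g" unfolding gderiv_def g[symmetric] by (rule D)
  have "gradient f y = g" unfolding gradient_def
  proof (rule the_equality)
    show "GDERIV f y :> g" by (rule G)
    fix D' assume "GDERIV f y :> D'"
    then have "(\<lambda>h. h \<bullet> D') = ?D" unfolding gderiv_def using D has_derivative_unique by blast
    then have "h \<bullet> D' = h \<bullet> g" for h using g by metis
    then show "D' = g" using vector_eq_ldot[of D' g] by simp
  qed
  then show ?thesis using g by simp
qed

lemma diffeomorphism_compose:
  assumes "diffeomorphism f S T" "diffeomorphism g T R"
  shows "diffeomorphism (\<lambda>x. g (f x)) S R"
proof -
  have f: "bij_betw f S T" "smooth_on S f" "smooth_on T (inv_into S f)"
    and g: "bij_betw g T R" "smooth_on T g" "smooth_on R (inv_into T g)"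
    using assms by (auto simp: diffeomorphism_def)
  have fS: "f ` S = T" and gT: "g ` T = R" using f(1) g(1) by (simp_all add: bij_betw_imp_surj_on)
  have "inv_into S (\<lambda>x. g (f x)) z = inv_into S f (inv_into T g z)" if "z \<in> R" for z
    using inv_into_comp[of g f S z] f(1) g(1) that fS gT by (simp add: bij_betw_def comp_def)
  moreover have "smooth_on R (\<lambda>z. inv_into S f (inv_into T g z))"
    using gT by (intro smooth_on_compose[OF g(3) f(3)]) (auto intro: inv_into_into)
  ultimately have "smooth_on R (inv_into S (\<lambda>x. g (f x)))" by (simp cong: smooth_on_cong)
  moreover have "bij_betw (\<lambda>x. g (f x)) S R"
    using bij_betw_trans[OF f(1) g(1)] by (simp add: comp_def)
  moreover have "smooth_on S (\<lambda>x. g (f x))"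
    using fS by (intro smooth_on_compose[OF f(2) g(2)]) auto
  ultimately show ?thesis by (simp add: diffeomorphism_def)
qed

text \<open>The inverse is an argument of its own, so that it is a smooth map of the whole space,
  images turn into preimages under \<open>G\<close>, and the notion is symmetric.\<close>

definition ambient_diffeo :: "('a::euclidean_space \<Rightarrow> 'b::euclidean_space) \<Rightarrow> ('b \<Rightarrow> 'a) \<Rightarrow> bool" where
  "ambient_diffeo \<Phi> G \<longleftrightarrow>
     smooth_on UNIV \<Phi> \<and> smooth_on UNIV G \<and> (\<forall>y. G (\<Phi> y) = y) \<and> (\<forall>z. \<Phi> (G z) = z)"

lemma ambient_diffeo_sym: "ambient_diffeo \<Phi> G \<Longrightarrow> ambient_diffeo G \<Phi>"
  by (simp add: ambient_diffeo_def)

lemma ambient_diffeo_compose: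
  "ambient_diffeo \<Phi> G \<Longrightarrow> ambient_diffeo \<Phi>' G' \<Longrightarrow>
    ambient_diffeo (\<lambda>y. \<Phi>' (\<Phi> y)) (\<lambda>z. G (G' z))"
  by (simp add: ambient_diffeo_def smooth_on_UNIV_compose)

lemma ambient_diffeo_image_eq:
  assumes "ambient_diffeo \<Phi> G"
  shows "\<Phi> ` S = G -` S"
proof
  show "\<Phi> ` S \<subseteq> G -` S" using assms by (auto simp: ambient_diffeo_def)
  show "G -` S \<subseteq> \<Phi> ` S"
  proof
    fix z assume "z \<in> G -` S"
    moreover have "z = \<Phi> (G z)" using assms by (simp add: ambient_diffeo_def)
    ultimately show "z \<in> \<Phi> ` S" by blast
  qed
qed

lemma ambient_diffeo_image_image:
  assumes "ambient_diffeo \<Phi> G"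
  shows "G ` \<Phi> ` S = S"
  using assms by (simp add: ambient_diffeo_def image_image)

lemma ambient_diffeo_open_image:
  assumes "ambient_diffeo \<Phi> G" "open U"
  shows "open (\<Phi> ` U)"
  unfolding ambient_diffeo_image_eq[OF assms(1)]
  using assms by (intro open_vimage smooth_on_UNIV_continuous) (simp_all add: ambient_diffeo_def)

lemma ambient_diffeo_diffeomorphism:
  assumes "ambient_diffeo \<Phi> G"
  shows "diffeomorphism \<Phi> S (\<Phi> ` S)"
proof -
  have \<Phi>: "smooth_on UNIV \<Phi>" "smooth_on UNIV G" "\<And>y. G (\<Phi> y) = y"
    using assms by (auto simp: ambient_diffeo_def)
  have inj: "inj_on \<Phi> S" using \<Phi>(3) by (rule inj_on_inverseI)
  have "inv_into S \<Phi> z = G z" if "z \<in> \<Phi> ` S" for z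
    using that inv_into_f_f[OF inj] \<Phi>(3) by auto
  then have "smooth_on (\<Phi> ` S) (inv_into S \<Phi>) \<longleftrightarrow> smooth_on (\<Phi> ` S) G" by (rule smooth_on_cong)
  then show ?thesis
    using smooth_on_subset[OF \<Phi>(1) subset_UNIV] smooth_on_subset[OF \<Phi>(2) subset_UNIV] inj
    by (simp add: diffeomorphism_def bij_betw_def)
qed

text \<open>The chart \<open>\<psi>\<close> is replaced by \<open>\<psi>\<close> after
  \<open>G\<close>, with the same \<open>Q\<close> and \<open>P\<close>. Charts live on open sets of
  the surrounding space, which is why the diffeomorphism has to be defined there and not merely on
  \<open>X\<close>.\<close>

lemma mgb_at_ambient_diffeo:
  fixes \<Phi> :: "real^'m \<Rightarrow> real^'m"
  assumes amb: "ambient_diffeo \<Phi> G" and "mgb_at X p0 q p"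
  shows "mgb_at (\<Phi> ` X) (\<Phi> p0) q p"
proof -
  obtain U V :: "(real^'m) set" and \<psi> Q P where *: "open U" "open V" "p0 \<in> U" "diffeomorphism \<psi> U V"
    "\<psi> p0 = 0" "Q \<inter> P = {}" "card Q = q" "card P = p"
    "\<psi> ` (U \<inter> X) = {v\<in>V. (\<forall>i\<in>Q. v $ i = 0) \<and> (\<forall>i\<in>P. v $ i \<ge> 0)}"
    using assms(2) unfolding mgb_at_def by blast
  have G: "G (\<Phi> y) = y" for y using amb by (simp add: ambient_diffeo_def)
  have "diffeomorphism G (\<Phi> ` U) U"
    using ambient_diffeo_diffeomorphism[OF ambient_diffeo_sym[OF amb], of "\<Phi> ` U"]
      ambient_diffeo_image_image[OF amb] by simp
  then have d: "diffeomorphism (\<lambda>z. \<psi> (G z)) (\<Phi> ` U) V" using *(4) by (rule diffeomorphism_compose)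
  have "inj \<Phi>" using G by (rule inj_on_inverseI)
  then have "\<Phi> ` U \<inter> \<Phi> ` X = \<Phi> ` (U \<inter> X)" by (simp add: image_Int)
  then have im: "(\<lambda>z. \<psi> (G z)) ` (\<Phi> ` U \<inter> \<Phi> ` X) = \<psi> ` (U \<inter> X)" by (simp add: image_image G)
  show ?thesis unfolding mgb_at_def
  proof (intro exI conjI)
    show "open (\<Phi> ` U)" by (rule ambient_diffeo_open_image[OF amb *(1)])
    show "\<Phi> p0 \<in> \<Phi> ` U" using *(3) by (rule imageI)
    show "\<psi> (G (\<Phi> p0)) = 0" using *(5) by (simp only: G)
    show "(\<lambda>z. \<psi> (G z)) ` (\<Phi> ` U \<inter> \<Phi> ` X) = {v\<in>V. (\<forall>i\<in>Q. v $ i = 0) \<and> (\<forall>i\<in>P. v $ i \<ge> 0)}"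
      unfolding im by (rule *(9))
  qed (fact *(2) d *(6-8))+
qed

lemma manifold_gb_ambient_diffeo:
  fixes \<Phi> :: "real^'m \<Rightarrow> real^'m"
  assumes "ambient_diffeo \<Phi> G" "manifold_gb s X"
  shows "manifold_gb s (\<Phi> ` X)"
  unfolding manifold_gb_def
proof
  fix z assume "z \<in> \<Phi> ` X"
  then obtain y where y: "y \<in> X" "z = \<Phi> y" by blast
  then obtain q p where "q + s = CARD('m)" "mgb_at X y q p"
    using assms(2) unfolding manifold_gb_def by blast
  then show "\<exists>q p. q + s = CARD('m) \<and> mgb_at (\<Phi> ` X) z q p"
    unfolding y(2) using mgb_at_ambient_diffeo[OF assms(1)] by blast
qed

lemma Sigma_set_ambient_diffeo:
  fixes \<Phi> :: "real^'m \<Rightarrow> real^'m"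
  assumes amb: "ambient_diffeo \<Phi> G"
  shows "Sigma_set s (\<Phi> ` X) l = \<Phi> ` Sigma_set s X l"
proof -
  \<comment> \<open>Stated for any ambient diffeomorphism, since the reverse inclusion is the same
    claim for \<open>G\<close> and the image of \<open>X\<close>.\<close>
  have sub: "\<Psi> ` Sigma_set s Z l \<subseteq> Sigma_set s (\<Psi> ` Z) l"
    if "ambient_diffeo \<Psi> H" for \<Psi> H :: "real^'m \<Rightarrow> real^'m" and Z :: "(real^'m) set"
  proof
    fix z assume "z \<in> \<Psi> ` Sigma_set s Z l"
    then obtain y q p where y: "y \<in> Z" "z = \<Psi> y" and "q + s = CARD('m)" "p + l = s" "mgb_at Z y q p"
      unfolding Sigma_set_def by blast
    moreover have "mgb_at (\<Psi> ` Z) z q p" unfolding y(2) by (rule mgb_at_ambient_diffeo) fact+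
    ultimately show "z \<in> Sigma_set s (\<Psi> ` Z) l" unfolding Sigma_set_def by blast
  qed
  have "G ` Sigma_set s (\<Phi> ` X) l \<subseteq> Sigma_set s X l"
    using sub[OF ambient_diffeo_sym[OF amb], of "\<Phi> ` X"] ambient_diffeo_image_image[OF amb] by simp
  then have "\<Phi> ` G ` Sigma_set s (\<Phi> ` X) l \<subseteq> \<Phi> ` Sigma_set s X l" by (rule image_mono)
  then show ?thesis
    unfolding ambient_diffeo_image_image[OF ambient_diffeo_sym[OF amb]]
    using sub[OF amb, of X] by (intro equalityI)
qed

lemma path_component_continuous_image:
  assumes "continuous_on UNIV f" "path_component S x y"
  shows "path_component (f ` S) (f x) (f y)"
proof -
  obtain g where g: "path g" "path_image g \<subseteq> S" "pathstart g = x" "pathfinish g = y"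
    using assms(2) unfolding path_component_def by blast
  have "path (f \<circ> g)" using g(1) continuous_on_subset[OF assms(1)] by (intro path_continuous_image) auto
  then show ?thesis unfolding path_component_def
    using g by (intro exI[of _ "f \<circ> g"]) (auto simp: path_image_compose pathstart_compose pathfinish_compose)
qed

lemma path_component_set_ambient_diffeo:
  assumes amb: "ambient_diffeo \<Phi> G"
  shows "path_component_set (\<Phi> ` S) (\<Phi> x) = \<Phi> ` path_component_set S x"
proof
  have c: "continuous_on UNIV \<Phi>" "continuous_on UNIV G"
    using amb smooth_on_UNIV_continuous by (auto simp: ambient_diffeo_def)
  show "\<Phi> ` path_component_set S x \<subseteq> path_component_set (\<Phi> ` S) (\<Phi> x)"
    using path_component_continuous_image[OF c(1)] by auto
  show "path_component_set (\<Phi> ` S) (\<Phi> x) \<subseteq> \<Phi> ` path_component_set S x"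
  proof
    fix z assume "z \<in> path_component_set (\<Phi> ` S) (\<Phi> x)"
    then have "path_component (G ` \<Phi> ` S) (G (\<Phi> x)) (G z)"
      using path_component_continuous_image[OF c(2)] by simp
    then have "G z \<in> path_component_set S x"
      using amb ambient_diffeo_image_image[OF amb] by (simp add: ambient_diffeo_def)
    then show "z \<in> \<Phi> ` path_component_set S x"
      using amb by (auto simp: ambient_diffeo_image_eq)
  qed
qed

text \<open>Strata are made from charts and path components only, and both are carried along by
  \<open>\<Phi>\<close>; the dimension \<open>l\<close> is kept, so the correspondence holds level
  by level.\<close>

lemma stratification_preserving_ambient_diffeo:
  fixes \<Phi> :: "real^'m \<Rightarrow> real^'m"
  assumes amb: "ambient_diffeo \<Phi> G"
  shows "stratification_preserving s \<Phi> X (\<Phi> ` X)"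
proof -
  have "strata s (\<Phi> ` X) l = (\<lambda>S. \<Phi> ` S) ` strata s X l" for l
    unfolding strata_def Sigma_set_ambient_diffeo[OF amb] image_image
      path_component_set_ambient_diffeo[OF amb] by (rule refl)
  then show ?thesis
    unfolding stratification_preserving_def natural_stratification_def by (simp add: image_UN)
qed

text \<open>The vectors \<open>n i\<close> are extended to a basis, and \<open>A\<close> records
  minus the inner products with it; a vector orthogonal to a spanning set is 0, so \<open>A\<close>
  is invertible. The sign turns the constraints \<open>n i \<bullet> z \<le> 0\<close> into
  nonnegative coordinates, as \<open>mgb_at\<close> asks.\<close>

lemma adapted_coordinates:
  fixes n :: "'i \<Rightarrow> real^'m"
  assumes "inj_on n J" "independent (n ` J)"
  obtains A B :: "real^'m \<Rightarrow> real^'m" and e :: "'i \<Rightarrow> 'm" and w :: "'i \<Rightarrow> real^'m"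
  where "linear A" "linear B" "\<And>z. B (A z) = z" "\<And>z. A (B z) = z" "inj_on e J"
    "\<And>i z. i \<in> J \<Longrightarrow> A z $ e i = - (n i \<bullet> z)"
    "\<And>i j. i \<in> J \<Longrightarrow> j \<in> J \<Longrightarrow> n i \<bullet> w j = (if i = j then 1 else 0)"
proof -
  define N where "N = extend_basis (n ` J)"
  have N: "n ` J \<subseteq> N" "independent N" "span N = UNIV"
    unfolding N_def using extend_basis_superset[OF assms(2)] independent_extend_basis[OF assms(2)]
      span_extend_basis[OF assms(2)] by auto
  have fin: "finite N" using N(2) by (rule finiteI_independent)
  \<comment> \<open>The basis has as many elements as the index type, so its members can be numbered
    by \<open>'m\<close>.\<close>
  have "card N = CARD('m)" using basis_card_eq_dim[of N UNIV] N(2,3) by simp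
  then obtain b :: "real^'m \<Rightarrow> 'm" where b: "bij_betw b N UNIV"
    using finite_same_card_bij[OF fin finite_class.finite_UNIV] by blast
  define c where "c = inv_into N b"
  define A where "A z = (\<chi> j. - (c j \<bullet> z))" for z
  have linA: "linear A" unfolding A_def
    by (rule linearI) (simp_all add: vec_eq_iff inner_add_right)
  have cb: "c (b v) = v" if "v \<in> N" for v
    unfolding c_def using b that by (simp add: bij_betw_inv_into_left)
  have "z = 0" if "A z = 0" for z
  proof -
    have orth: "orthogonal z v" if "v \<in> N" for v
    proof -
      have "A z $ b v = 0" using \<open>A z = 0\<close> by simp
      then show ?thesis using cb[OF that] by (simp add: A_def orthogonal_def inner_commute)
    qed
    have "z \<in> span N" using N(3) by simp
    then have "orthogonal z z" using orthogonal_to_span[of z N z] orth by blast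
    then show ?thesis by (simp add: orthogonal_def)
  qed
  then have injA: "inj A" using linear_injective_0[OF linA] by blast
  have "\<exists>B. linear B \<and> (\<forall>z. B (A z) = z) \<and> (\<forall>z. A (B z) = z)"
    using linear_injective_isomorphism[OF linA injA] by simp
  then obtain B where B': "linear B \<and> (\<forall>z. B (A z) = z) \<and> (\<forall>z. A (B z) = z)" by (rule exE)
  then have B: "linear B" "\<And>z. B (A z) = z" "\<And>z. A (B z) = z" by simp_all
  define e where "e i = b (n i)" for i
  \<comment> \<open>Dual vectors are preimages of coordinate vectors; the entry -1 cancels the sign
    built into \<open>A\<close>.\<close>
  define w where "w j = B (axis (e j) (- 1))" for j
  have inj: "inj_on e J"
  proof (rule inj_onI)
    fix i j assume ij: "i \<in> J" "j \<in> J" "e i = e j"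
    then have "n i \<in> N" "n j \<in> N" using N(1) by auto
    then have "n i = n j" using cb ij(3) unfolding e_def by metis
    then show "i = j" using assms(1) ij by (simp add: inj_on_def)
  qed
  have Ae: "A z $ e i = - (n i \<bullet> z)" if "i \<in> J" for i z
    using cb[of "n i"] N(1) that by (auto simp: A_def e_def)
  have "n i \<bullet> w j = (if i = j then 1 else 0)" if "i \<in> J" "j \<in> J" for i j
  proof -
    have "n i \<bullet> w j = - (A (w j) $ e i)" using Ae[OF that(1)] by simp
    also have "\<dots> = - (axis (e j) (- 1) $ e i)" by (simp add: w_def B(3))
    also have "\<dots> = (if i = j then 1 else 0)" using inj that by (simp add: axis_def inj_on_eq_iff)
    finally show ?thesis .
  qed
  with linA B inj Ae show thesis by (rule that)
qed

section \<open>Straightening the active constraints\<close>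

text \<open>
  The map \<open>E y = y + \<beta> y *\<^sub>R (\<Sum>i\<in>J. (h i y - n i \<bullet> (y - p)) *\<^sub>R w i)\<close> satisfies
  \<open>n i \<bullet> (E y - p) = h i y\<close> for \<open>i \<in> J\<close> and \<open>y\<close> near \<open>p\<close>: it straightens the constraints active
  at \<open>p\<close> simultaneously. It is also a global diffeomorphism, because the correction added to the
  identity vanishes to first order at \<open>p\<close>, so its cut-off at scale \<open>\<delta>\<close> is a contraction for
  small \<open>\<delta>\<close>. The linear map \<open>A\<close> makes the \<open>- n i\<close> into coordinates.
\<close>

locale straightening =
  fixes I J :: "'i set" and h :: "'i \<Rightarrow> real^'m \<Rightarrow> real" and n w :: "'i \<Rightarrow> real^'m"
    and p :: "real^'m" and W :: "(real^'m) set" and \<delta> c :: real and \<beta> :: "real^'m \<Rightarrow> real"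
    and A B :: "real^'m \<Rightarrow> real^'m" and e :: "'i \<Rightarrow> 'm"
  assumes finite_I: "finite I" and J_subset: "J \<subseteq> I"
    and active: "i \<in> J \<Longrightarrow> h i p = 0"
    and inactive: "i \<in> I - J \<Longrightarrow> y \<in> cball p (2 * \<delta>) \<Longrightarrow> h i y \<le> - c"
    and \<delta>_pos: "0 < \<delta>" and c_pos: "0 < c" and cball_W: "cball p (2 * \<delta>) \<subseteq> W"
    and linear_A: "linear A" and linear_B: "linear B"
    and B_A: "B (A z) = z" and A_B: "A (B z) = z"
    and inj_e: "inj_on e J" and A_nth: "i \<in> J \<Longrightarrow> A z $ e i = - (n i \<bullet> z)"
    and dual: "i \<in> J \<Longrightarrow> j \<in> J \<Longrightarrow> n i \<bullet> w j = (if i = j then 1 else 0)"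
    and smooth_\<beta>: "smooth_on UNIV \<beta>"
    and \<beta>_1: "y \<in> cball p \<delta> \<Longrightarrow> \<beta> y = 1" and \<beta>_0: "y \<notin> cball p (2 * \<delta>) \<Longrightarrow> \<beta> y = 0"
    and contraction: "derivative_bound (1/4) (\<lambda>y. \<beta> y *\<^sub>R (\<Sum>i\<in>J. (h i y - n i \<bullet> (y - p)) *\<^sub>R w i))"

text \<open>The uncut correction \<open>f\<close> and its derivative vanish at \<open>p\<close>:
  there the \<open>h i\<close> with \<open>i \<in> J\<close> are 0 and have gradient
  \<open>n i\<close>. If the derivative is at most \<eta> on the ball of radius
  \<open>2 * \<delta>\<close>, then \<open>f\<close> is at most \<open>2 * \<delta> * \<eta>\<close>
  there. The derivative \<open>C / \<delta>\<close> of the cutoff therefore costs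
  \<open>2 * C * \<eta>\<close>, whatever \<delta> is.\<close>

lemma straightening_exists:
  fixes h :: "'i \<Rightarrow> real^'m \<Rightarrow> real" and p :: "real^'m"
  defines "n \<equiv> \<lambda>i. gradient (h i) p"
  assumes I: "finite I" and h: "\<And>i. i \<in> I \<Longrightarrow> smooth_on UNIV (h i)" and hp: "\<And>i. i \<in> I \<Longrightarrow> h i p \<le> 0"
    and J: "J = {i\<in>I. h i p = 0}" and inj: "inj_on n J" and ind: "independent (n ` J)"
    and W: "open W" "p \<in> W"
  obtains w \<delta> c \<beta> A B e where "straightening I J h n w p W \<delta> c \<beta> A B e"
proof -
  have JI: "J \<subseteq> I" and hJ: "\<And>i. i \<in> J \<Longrightarrow> h i p = 0" and hJ': "\<And>i. i \<in> I - J \<Longrightarrow> h i p < 0"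
    using J hp by force+
  obtain A B :: "real^'m \<Rightarrow> real^'m" and e :: "'i \<Rightarrow> 'm" and w :: "'i \<Rightarrow> real^'m"
    where lin: "linear A" "linear B" "\<And>z. B (A z) = z" "\<And>z. A (B z) = z" "inj_on e J"
    "\<And>i z. i \<in> J \<Longrightarrow> A z $ e i = - (n i \<bullet> z)"
    "\<And>i j. i \<in> J \<Longrightarrow> j \<in> J \<Longrightarrow> n i \<bullet> w j = (if i = j then 1 else 0)"
    by (rule adapted_coordinates[OF inj ind]) (rule that)
  define f where "f y = (\<Sum>i\<in>J. (h i y - n i \<bullet> (y - p)) *\<^sub>R w i)" for y
  have aff: "smooth_on UNIV (\<lambda>y. n i \<bullet> (y - p))" for i
    unfolding inner_diff_right
    by (intro smooth_on_diff smooth_on_const smooth_on_bounded_linear bounded_linear_inner_right)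
  have sf: "smooth_on UNIV f" unfolding f_def
    by (intro smooth_on_sum smooth_on_scaleR smooth_on_diff smooth_on_const h aff) (use JI in blast)
  let ?Df = "\<lambda>y. frechet_derivative f (at y)"
  have linDf: "linear (?Df y)" for y
    using smooth_on_UNIV_has_derivative[OF sf] by (rule has_derivative_linear)
  have Dfp: "?Df p v = 0" for v
  proof -
    have "(f has_derivative (\<lambda>v. \<Sum>i\<in>J. (frechet_derivative (h i) (at p) v - n i \<bullet> v) *\<^sub>R w i)) (at p)"
      unfolding f_def
      by (intro has_derivative_sum has_derivative_scaleR_left has_derivative_diff
          smooth_on_UNIV_has_derivative h) (use JI in \<open>auto intro!: derivative_eq_intros\<close>)
    then have "?Df p v = (\<Sum>i\<in>J. (frechet_derivative (h i) (at p) v - n i \<bullet> v) *\<^sub>R w i)"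
      by (simp add: frechet_derivative_at[symmetric])
    also have "\<dots> = 0"
    proof (rule sum.neutral, rule ballI)
      fix i assume "i \<in> J"
      then have "i \<in> I" using JI by blast
      then show "(frechet_derivative (h i) (at p) v - n i \<bullet> v) *\<^sub>R w i = 0"
        using frechet_derivative_gradient[OF h, of i p v] by (simp add: n_def inner_commute)
    qed
    finally show ?thesis .
  qed
  obtain C :: real where C: "C \<ge> 0"
    "\<And>(p :: real^'m) a. a > 0 \<Longrightarrow> \<exists>\<beta>. smooth_on UNIV \<beta> \<and> (\<forall>y. 0 \<le> \<beta> y \<and> \<beta> y \<le> 1) \<and>
       (\<forall>y\<in>cball p a. \<beta> y = 1) \<and> (\<forall>y. y \<notin> ball p (2 * a) \<longrightarrow> \<beta> y = 0) \<and>
       (\<forall>y v. \<bar>frechet_derivative \<beta> (at y) v\<bar> \<le> C / a * norm v)"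
    by (rule bump_exists) (rule that)
  \<comment> \<open>Chosen so that the final bound \<open>(1 + 2 * C) * \<eta>\<close> equals
    1/4.\<close>
  define \<eta> where "\<eta> = 1 / (4 * (1 + 2 * C))"
  have \<eta>: "\<eta> > 0" using C(1) by (simp add: \<eta>_def)
  have "\<exists>c>0. \<forall>i\<in>I - J. h i p < - c"
  proof (intro exI conjI ballI)
    \<comment> \<open>Inserting 1 keeps the minimum meaningful when every constraint is active;
      halving makes the inequality at \<open>p\<close> strict, so that it persists nearby.\<close>
    let ?c = "Min (insert 1 ((\<lambda>i. - h i p / 2) ` (I - J)))"
    show "?c > 0" using I hJ' by (subst Min_gr_iff) auto
    show "h i p < - ?c" if "i \<in> I - J" for i
    proof -
      have "?c \<le> - h i p / 2" using I that by (intro Min_le) auto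
      then show ?thesis using hJ'[OF that] by simp
    qed
  qed
  then obtain c where c: "c > 0" "\<And>i. i \<in> I - J \<Longrightarrow> h i p < - c" by blast
  have ev1: "\<forall>\<^sub>F y in nhds p. \<forall>i\<in>I - J. h i y < - c"
  proof (rule eventually_ball_finite)
    show "finite (I - J)" using I by simp
    show "\<forall>i\<in>I - J. \<forall>\<^sub>F y in nhds p. h i y < - c"
    proof
      fix i assume i: "i \<in> I - J"
      then have "isCont (h i) p"
        using smooth_on_UNIV_continuous[OF h, of i UNIV] by (simp add: continuous_on_eq_continuous_at)
      then have "(h i \<longlongrightarrow> h i p) (nhds p)" by (simp add: isCont_def tendsto_nhds_iff)
      then show "\<forall>\<^sub>F y in nhds p. h i y < - c" using c(2)[OF i] by (rule order_tendstoD)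
    qed
  qed
  have ev2: "\<forall>\<^sub>F y in nhds p. (\<Sum>b\<in>Basis. norm (?Df y b)) < \<eta>"
  proof -
    have "continuous_on UNIV (\<lambda>y. \<Sum>b\<in>Basis. norm (?Df y b))"
      by (intro continuous_on_sum continuous_on_norm smooth_on_UNIV_continuous
          smooth_on_UNIV_frechet_derivative sf)
    then have "isCont (\<lambda>y. \<Sum>b\<in>Basis. norm (?Df y b)) p" by (simp add: continuous_on_eq_continuous_at)
    then have "((\<lambda>y. \<Sum>b\<in>Basis. norm (?Df y b)) \<longlongrightarrow> (\<Sum>b\<in>Basis. norm (?Df p b))) (nhds p)"
      by (simp add: isCont_def tendsto_nhds_iff)
    then show ?thesis by (rule order_tendstoD) (simp add: Dfp \<eta>)
  qed
  have ev3: "\<forall>\<^sub>F y in nhds p. y \<in> W" using W by (rule eventually_nhds_in_open)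
  obtain d where d: "d > 0" "\<And>y. dist y p < d \<Longrightarrow>
      (\<forall>i\<in>I - J. h i y < - c) \<and> (\<Sum>b\<in>Basis. norm (?Df y b)) < \<eta> \<and> y \<in> W"
    using eventually_conj[OF ev1 eventually_conj[OF ev2 ev3]] unfolding eventually_nhds_metric by blast
  \<comment> \<open>A third, so that the closed ball of radius \<open>2 * \<delta>\<close> lies
    inside the open ball of radius \<open>d\<close>.\<close>
  define \<delta> where "\<delta> = d / 3"
  have \<delta>: "\<delta> > 0" using d(1) by (simp add: \<delta>_def)
  let ?K = "cball p (2 * \<delta>)"
  have K: "dist y p < d" if "y \<in> ?K" for y
    using that d(1) by (simp add: \<delta>_def dist_commute)
  have Df: "norm (?Df y v) \<le> \<eta> * norm v" if "y \<in> ?K" for y v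
  proof -
    have "(\<Sum>b\<in>Basis. norm (?Df y b)) * norm v \<le> \<eta> * norm v"
      using d(2)[OF K[OF that]] by (intro mult_right_mono) auto
    then show ?thesis using norm_linear_le_Basis[OF linDf, of y v] by linarith
  qed
  have fb: "norm (f y) \<le> 2 * \<delta> * \<eta>" if y: "y \<in> ?K" for y
  proof -
    have "norm (f y - f p) \<le> \<eta> * norm (y - p)"
    proof (rule differentiable_bound[of ?K])
      show "(f has_derivative ?Df z) (at z within ?K)" for z
        by (rule has_derivative_at_withinI) (rule smooth_on_UNIV_has_derivative[OF sf])
      show "onorm (?Df z) \<le> \<eta>" if "z \<in> ?K" for z using Df[OF that] by (rule onorm_le)
      show "p \<in> ?K" using \<delta> by simp
    qed (use y in simp_all)
    also have "\<dots> \<le> \<eta> * (2 * \<delta>)"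
      using y \<eta> by (intro mult_left_mono) (simp_all add: dist_norm norm_minus_commute)
    finally show ?thesis using hJ by (simp add: f_def mult.commute)
  qed
  obtain \<beta> where \<beta>: "smooth_on UNIV \<beta>" "\<And>y. 0 \<le> \<beta> y" "\<And>y. \<beta> y \<le> 1"
    "\<And>y. y \<in> cball p \<delta> \<Longrightarrow> \<beta> y = 1" "\<And>y. y \<notin> ball p (2 * \<delta>) \<Longrightarrow> \<beta> y = 0"
    "\<And>y v. \<bar>frechet_derivative \<beta> (at y) v\<bar> \<le> C / \<delta> * norm v"
    using C(2)[OF \<delta>, of p] by blast
  have \<beta>0: "\<beta> y = 0" if "y \<notin> ?K" for y using that by (intro \<beta>(5)) simp
  have "derivative_bound (1 * \<eta> + C / \<delta> * (2 * \<delta> * \<eta>)) (\<lambda>y. \<beta> y *\<^sub>R f y)"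
  proof (rule derivative_bound_cutoff[where K = ?K])
    show "\<bar>\<beta> y\<bar> \<le> 1" for y using \<beta>(2,3)[of y] by simp
  qed (use \<beta>(1,6) sf \<beta>0 C(1) \<delta> \<eta> Df fb in simp_all)
  moreover have "1 * \<eta> + C / \<delta> * (2 * \<delta> * \<eta>) = 1 / 4"
  proof -
    have "1 * \<eta> + C / \<delta> * (2 * \<delta> * \<eta>) = (1 + 2 * C) * \<eta>" using \<delta> by (simp add: field_simps)
    also have "\<dots> = 1 / 4" using C(1) by (simp add: \<eta>_def field_simps)
    finally show ?thesis .
  qed
  ultimately have bd: "derivative_bound (1/4) (\<lambda>y. \<beta> y *\<^sub>R (\<Sum>i\<in>J. (h i y - n i \<bullet> (y - p)) *\<^sub>R w i))"
    by (simp only: f_def)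
  have KW: "?K \<subseteq> W" using d(2) K by blast
  have hc: "h i y \<le> - c" if "i \<in> I - J" "y \<in> ?K" for i y
    using d(2)[OF K[OF that(2)]] that(1) by (simp add: less_imp_le)
  have "straightening I J h n w p W \<delta> c \<beta> A B e"
    by (rule straightening.intro) (fact I JI hJ hc \<delta> c(1) KW lin \<beta>(1,4) \<beta>0 bd)+
  then show thesis by (rule that)
qed

lemma inner_dual_sum:
  assumes "finite J" "\<And>i j. i \<in> J \<Longrightarrow> j \<in> J \<Longrightarrow> n i \<bullet> w j = (if i = j then 1 else 0)" "i \<in> J"
  shows "n i \<bullet> (\<Sum>j\<in>J. a j *\<^sub>R w j) = a i"
proof -
  have "n i \<bullet> (\<Sum>j\<in>J. a j *\<^sub>R w j) = (\<Sum>j\<in>J. if i = j then a j else 0)"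
    unfolding inner_sum_right by (rule sum.cong) (simp_all add: assms)
  then show ?thesis using assms(1,3) by simp
qed

lemma identity_plus_contraction_ambient_diffeo:
  fixes u :: "real^'m \<Rightarrow> real^'m"
  assumes "derivative_bound c u" "0 \<le> c" "c < 1"
  obtains G where "ambient_diffeo (\<lambda>y. y + u y) G"
proof -
  obtain G where G: "smooth_on UNIV G" "\<And>y. G (y + u y) = y" "\<And>y. G y + u (G y) = y"
    by (rule identity_plus_contraction_diffeo[OF assms]) (rule that)
  have "smooth_on UNIV (\<lambda>y. y + u y)"
    using assms(1) by (intro smooth_on_add smooth_on_ident) (simp add: derivative_bound_def)
  with G have "ambient_diffeo (\<lambda>y. y + u y) G" by (simp add: ambient_diffeo_def)
  then show thesis by (rule that)
qed

context straightening
begin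

text \<open>The chart is the straightening followed by \<open>A\<close>, restricted to
  \<open>ball p \<delta>\<close>, where \<beta> is 1. The coordinates \<open>e i\<close> become
  \<open>- h i\<close>, and inactive constraints hold throughout the ball. There are no equations,
  hence \<open>q = 0\<close>.\<close>

lemma mgb_at_feasible: "mgb_at {y. \<forall>i\<in>I. h i y \<le> 0} p 0 (card J)"
proof -
  have fJ: "finite J" using J_subset finite_I by (rule finite_subset)
  define u where "u y = \<beta> y *\<^sub>R (\<Sum>i\<in>J. (h i y - n i \<bullet> (y - p)) *\<^sub>R w i)" for y
  have "derivative_bound (1/4) u" unfolding u_def by (rule contraction)
  then obtain G where G: "ambient_diffeo (\<lambda>y. y + u y) G"
    by (rule identity_plus_contraction_ambient_diffeo) simp_all
  have AB: "ambient_diffeo (\<lambda>y. A (y - p)) (\<lambda>z. B z + p)"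
    unfolding ambient_diffeo_def
  proof (intro conjI allI)
    have s: "smooth_on UNIV A" "smooth_on UNIV B"
      using linear_A linear_B by (simp_all add: smooth_on_bounded_linear linear_conv_bounded_linear)
    show "smooth_on UNIV (\<lambda>y. A (y - p))"
      by (rule smooth_on_UNIV_compose[OF s(1)], intro smooth_on_diff smooth_on_ident smooth_on_const)
    show "smooth_on UNIV (\<lambda>z. B z + p)" by (intro smooth_on_add smooth_on_const s)
  qed (simp_all add: B_A A_B)
  define \<psi> where "\<psi> y = A (y + u y - p)" for y
  have amb: "ambient_diffeo \<psi> (\<lambda>z. G (B z + p))"
    using ambient_diffeo_compose[OF G AB] by (simp add: \<psi>_def[abs_def])
  have \<psi>e: "\<psi> y $ e i = - h i y" if "i \<in> J" "y \<in> ball p \<delta>" for i y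
  proof -
    have "\<beta> y = 1" using that(2) by (intro \<beta>_1) simp
    then have "n i \<bullet> u y = h i y - n i \<bullet> (y - p)"
      using inner_dual_sum[OF fJ dual that(1)] by (simp add: u_def)
    then have "n i \<bullet> (y + u y - p) = h i y" by (simp add: inner_add_right inner_diff_right)
    then show ?thesis using A_nth[OF that(1)] by (simp add: \<psi>_def)
  qed
  have feas: "(\<forall>i\<in>I. h i y \<le> 0) \<longleftrightarrow> (\<forall>j\<in>e ` J. \<psi> y $ j \<ge> 0)" if y: "y \<in> ball p \<delta>" for y
  proof -
    have "y \<in> cball p (2 * \<delta>)" using y \<delta>_pos by simp
    then have "h i y \<le> 0" if "i \<in> I - J" for i
      using inactive[OF that, of y] c_pos by linarith
    then have "(\<forall>i\<in>I. h i y \<le> 0) \<longleftrightarrow> (\<forall>i\<in>J. h i y \<le> 0)" using J_subset by blast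
    then show ?thesis using \<psi>e[OF _ y] by simp
  qed
  show ?thesis unfolding mgb_at_def
  proof (intro exI conjI)
    show "open (ball p \<delta>)" by (rule open_ball)
    show "open (\<psi> ` ball p \<delta>)" by (rule ambient_diffeo_open_image[OF amb open_ball])
    show "p \<in> ball p \<delta>" using \<delta>_pos by simp
    show "diffeomorphism \<psi> (ball p \<delta>) (\<psi> ` ball p \<delta>)" by (rule ambient_diffeo_diffeomorphism[OF amb])
    have "u p = 0" using active by (simp add: u_def)
    then show "\<psi> p = 0" using linear_A by (simp add: \<psi>_def linear_0)
    show "{} \<inter> e ` J = {}" "card ({} :: 'm set) = 0" by simp_all
    show "card (e ` J) = card J" using inj_e by (rule card_image)
    show "\<psi> ` (ball p \<delta> \<inter> {y. \<forall>i\<in>I. h i y \<le> 0}) =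
        {v \<in> \<psi> ` ball p \<delta>. (\<forall>i\<in>{}. v $ i = 0) \<and> (\<forall>i\<in>e ` J. v $ i \<ge> 0)}"
      using feas by blast
  qed
qed

end

text \<open>The point is the order of quantifiers: \<open>M\<close> depends on the cutoff and
  \<open>K\<close> alone, so \<epsilon> can be chosen afterwards, uniformly in the
  perturbation.\<close>

lemma derivative_bound_small_perturbation:
  fixes \<tau> :: "'a::euclidean_space \<Rightarrow> real"
  assumes \<tau>: "smooth_on UNIV \<tau>" "compact K" "\<And>y. y \<notin> K \<Longrightarrow> \<tau> y = 0"
  obtains M where "M \<ge> 0"
    "\<And>\<epsilon> r (w :: 'b::euclidean_space). \<epsilon> \<ge> 0 \<Longrightarrow> smooth_on UNIV r \<Longrightarrow>
      (\<And>y. y \<in> K \<Longrightarrow> \<bar>r y\<bar> \<le> \<epsilon> \<and> norm (gradient r y) \<le> \<epsilon>) \<Longrightarrow>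
      derivative_bound (M * \<epsilon> * norm w) (\<lambda>y. \<tau> y *\<^sub>R (r y *\<^sub>R w))"
proof -
  obtain D where D: "D \<ge> 0" "\<And>y v. y \<in> K \<Longrightarrow> norm (frechet_derivative \<tau> (at y) v) \<le> D * norm v"
    by (rule smooth_derivative_bounded_on_compact[OF \<tau>(1,2)]) (rule that)
  have "bounded (\<tau> ` K)"
    by (intro compact_imp_bounded compact_continuous_image smooth_on_UNIV_continuous \<tau>)
  then obtain T where "T > 0" "\<And>t. t \<in> \<tau> ` K \<Longrightarrow> norm t \<le> T" unfolding bounded_pos by blast
  then have T: "T \<ge> 0" "\<And>y. y \<in> K \<Longrightarrow> \<bar>\<tau> y\<bar> \<le> T" by auto
  show thesis
  proof (rule that[of "T + D"])
    show "T + D \<ge> 0" using T(1) D(1) by simp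
    fix \<epsilon> and r :: "'a \<Rightarrow> real" and w :: 'b
    assume \<epsilon>: "\<epsilon> \<ge> 0" and r: "smooth_on UNIV r"
      and small: "\<And>y. y \<in> K \<Longrightarrow> \<bar>r y\<bar> \<le> \<epsilon> \<and> norm (gradient r y) \<le> \<epsilon>"
    have d: "frechet_derivative (\<lambda>y. r y *\<^sub>R w) (at y) v = (v \<bullet> gradient r y) *\<^sub>R w" for y v
    proof -
      have "((\<lambda>y. r y *\<^sub>R w) has_derivative (\<lambda>v. frechet_derivative r (at y) v *\<^sub>R w)) (at y)"
        by (intro has_derivative_scaleR_left smooth_on_UNIV_has_derivative r)
      then show ?thesis
        by (simp add: frechet_derivative_at[symmetric] frechet_derivative_gradient[OF r])
    qed
    have "derivative_bound (T * (\<epsilon> * norm w) + D * (\<epsilon> * norm w)) (\<lambda>y. \<tau> y *\<^sub>R (r y *\<^sub>R w))"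
    proof (rule derivative_bound_cutoff[where K = K])
      show "smooth_on UNIV (\<lambda>y. r y *\<^sub>R w)" by (intro smooth_on_scaleR r smooth_on_const)
      show "closed K" using \<tau>(2) by (rule compact_imp_closed)
      show "norm (r y *\<^sub>R w) \<le> \<epsilon> * norm w" if "y \<in> K" for y
        using small[OF that] by (simp add: mult_right_mono)
      show "norm (frechet_derivative (\<lambda>y. r y *\<^sub>R w) (at y) v) \<le> \<epsilon> * norm w * norm v" if "y \<in> K" for y v
      proof -
        have "\<bar>v \<bullet> gradient r y\<bar> \<le> norm v * norm (gradient r y)" by (rule Cauchy_Schwarz_ineq2)
        also have "\<dots> \<le> norm v * \<epsilon>" using small[OF that] by (simp add: mult_left_mono)
        finally have "\<bar>v \<bullet> gradient r y\<bar> * norm w \<le> norm v * \<epsilon> * norm w" by (rule mult_right_mono) simp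
        then show ?thesis unfolding d by (simp add: algebra_simps)
      qed
    qed (use \<tau>(1,3) T D \<epsilon> in simp_all)
    then show "derivative_bound ((T + D) * \<epsilon> * norm w) (\<lambda>y. \<tau> y *\<^sub>R (r y *\<^sub>R w))" by (simp add: algebra_simps)
  qed
qed

text \<open>
  For all small perturbations \<open>r\<close>, an ambient diffeomorphism carries the feasible set of
  \<open>h + \<sigma> r\<close> onto that of \<open>h + \<tau> r\<close>.
\<close>

definition cutoff_equivalent ::
    "'i set \<Rightarrow> ('i \<Rightarrow> 'a \<Rightarrow> real) \<Rightarrow> 'a set \<Rightarrow> ('a \<Rightarrow> real) \<Rightarrow> ('a::euclidean_space \<Rightarrow> real) \<Rightarrow> bool" where
  "cutoff_equivalent I h W \<sigma> \<tau> \<longleftrightarrow>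
    (\<exists>\<epsilon>>0. \<forall>r. (\<forall>i\<in>I. smooth_on UNIV (r i) \<and> (\<forall>y\<in>W. \<bar>r i y\<bar> \<le> \<epsilon> \<and> norm (gradient (r i) y) \<le> \<epsilon>)) \<longrightarrow>
      (\<exists>\<Phi> G. ambient_diffeo \<Phi> G \<and>
        (\<forall>y. (\<forall>i\<in>I. h i (\<Phi> y) + \<tau> (\<Phi> y) * r i (\<Phi> y) \<le> 0) \<longleftrightarrow>
             (\<forall>i\<in>I. h i y + \<sigma> y * r i y \<le> 0))))"

text \<open>
  The diffeomorphism is \<open>F\<^sup>-\<^sup>1 \<circ> E\<close>, where \<open>E\<close> and \<open>F\<close> straighten \<open>h + \<sigma> r\<close> and
  \<open>h + (\<sigma> + \<rho>) r\<close>. It is the identity where \<open>\<rho>\<close> vanishes, since \<open>E = F\<close> there, so it only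
  moves points of the ball on which the straightening identities are valid.
\<close>

lemma (in straightening) cutoff_perturbation_step:
  assumes \<sigma>: "smooth_on UNIV \<sigma>" "\<And>y. 0 \<le> \<sigma> y" "\<And>y. \<sigma> y \<le> 1"
    and \<rho>: "smooth_on UNIV \<rho>" "\<And>y. 0 \<le> \<rho> y" "\<And>y. \<sigma> y + \<rho> y \<le> 1" "\<And>y. y \<notin> ball p \<delta> \<Longrightarrow> \<rho> y = 0"
  shows "cutoff_equivalent I h W \<sigma> (\<lambda>y. \<sigma> y + \<rho> y)"
proof -
  let ?K = "cball p (2 * \<delta>)"
  have fJ: "finite J" using J_subset finite_I by (rule finite_subset)
  obtain M1 where M1: "M1 \<ge> 0" "\<And>\<epsilon> r (w :: real^'m). \<epsilon> \<ge> 0 \<Longrightarrow> smooth_on UNIV r \<Longrightarrow>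
      (\<And>y. y \<in> ?K \<Longrightarrow> \<bar>r y\<bar> \<le> \<epsilon> \<and> norm (gradient r y) \<le> \<epsilon>) \<Longrightarrow>
      derivative_bound (M1 * \<epsilon> * norm w) (\<lambda>y. (\<beta> y * \<sigma> y) *\<^sub>R (r y *\<^sub>R w))"
    by (rule derivative_bound_small_perturbation[of "\<lambda>y. \<beta> y * \<sigma> y" ?K])
      (use smooth_on_mult[OF smooth_\<beta> \<sigma>(1)] \<beta>_0 in auto)
  obtain M2 where M2: "M2 \<ge> 0" "\<And>\<epsilon> r (w :: real^'m). \<epsilon> \<ge> 0 \<Longrightarrow> smooth_on UNIV r \<Longrightarrow>
      (\<And>y. y \<in> ?K \<Longrightarrow> \<bar>r y\<bar> \<le> \<epsilon> \<and> norm (gradient r y) \<le> \<epsilon>) \<Longrightarrow>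
      derivative_bound (M2 * \<epsilon> * norm w) (\<lambda>y. \<rho> y *\<^sub>R (r y *\<^sub>R w))"
    by (rule derivative_bound_small_perturbation[of \<rho> ?K]) (use \<rho>(1,4) \<delta>_pos in auto)
  define \<omega> where "\<omega> = (\<Sum>i\<in>J. norm (w i))"
  define L where "L = (M1 + M2) * \<omega>"
  have L: "L \<ge> 0" using M1(1) M2(1) by (simp add: L_def \<omega>_def sum_nonneg)
  \<comment> \<open>The bound \<open>c / 2\<close> keeps inactive constraints negative on the ball.
    The other bound makes all perturbation terms together contribute at most 1/4 to the derivative,
    so with the 1/4 of \<open>contraction\<close> the maps below have constant 1/2;
    \<open>L + 1\<close> avoids division by 0.\<close>
  define \<epsilon> where "\<epsilon> = min (c / 2) (1 / (4 * (L + 1)))"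
  have \<epsilon>: "\<epsilon> > 0" "\<epsilon> < c" using L c_pos by (simp_all add: \<epsilon>_def min_less_iff_disj)
  have L\<epsilon>: "L * \<epsilon> \<le> 1 / 4"
  proof -
    have "L * \<epsilon> \<le> (L + 1) * (1 / (4 * (L + 1)))"
      using L \<epsilon> by (intro mult_mono) (simp_all add: \<epsilon>_def)
    also have "\<dots> = 1 / 4" using L by (simp add: field_simps)
    finally show ?thesis .
  qed
  show ?thesis unfolding cutoff_equivalent_def
  proof (intro exI[of _ \<epsilon>] conjI allI impI)
    show "\<epsilon> > 0" by (rule \<epsilon>)
    fix r :: "'i \<Rightarrow> real^'m \<Rightarrow> real"
    assume r: "\<forall>i\<in>I. smooth_on UNIV (r i) \<and> (\<forall>y\<in>W. \<bar>r i y\<bar> \<le> \<epsilon> \<and> norm (gradient (r i) y) \<le> \<epsilon>)"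
    have rK: "\<bar>r i y\<bar> \<le> \<epsilon>" "norm (gradient (r i) y) \<le> \<epsilon>" if "i \<in> I" "y \<in> ?K" for i y
      using r that cball_W by blast+
    define u where "u y = \<beta> y *\<^sub>R (\<Sum>i\<in>J. (h i y - n i \<bullet> (y - p)) *\<^sub>R w i) +
      (\<Sum>i\<in>J. (\<beta> y * \<sigma> y) *\<^sub>R (r i y *\<^sub>R w i))" for y
    \<comment> \<open>No factor \<beta> is needed on \<rho>, which is supported where \<beta> is 1.
      Thus \<open>u\<close> and \<open>v\<close> differ only by \<rho> terms and agree wherever
      \<rho> is 0.\<close>
    define v where "v y = u y + (\<Sum>i\<in>J. \<rho> y *\<^sub>R (r i y *\<^sub>R w i))" for y
    have b1: "derivative_bound (\<Sum>i\<in>J. M1 * \<epsilon> * norm (w i)) (\<lambda>y. \<Sum>i\<in>J. (\<beta> y * \<sigma> y) *\<^sub>R (r i y *\<^sub>R w i))"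
    proof (rule derivative_bound_sum)
      fix i assume "i \<in> J"
      then have "i \<in> I" using J_subset by blast
      then show "derivative_bound (M1 * \<epsilon> * norm (w i)) (\<lambda>y. (\<beta> y * \<sigma> y) *\<^sub>R (r i y *\<^sub>R w i))"
        using \<epsilon> r rK by (intro M1(2)) auto
    qed
    have b2: "derivative_bound (\<Sum>i\<in>J. M2 * \<epsilon> * norm (w i)) (\<lambda>y. \<Sum>i\<in>J. \<rho> y *\<^sub>R (r i y *\<^sub>R w i))"
    proof (rule derivative_bound_sum)
      fix i assume "i \<in> J"
      then have "i \<in> I" using J_subset by blast
      then show "derivative_bound (M2 * \<epsilon> * norm (w i)) (\<lambda>y. \<rho> y *\<^sub>R (r i y *\<^sub>R w i))"
        using \<epsilon> r rK by (intro M2(2)) auto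
    qed
    have s: "(\<Sum>i\<in>J. M1 * \<epsilon> * norm (w i)) + (\<Sum>i\<in>J. M2 * \<epsilon> * norm (w i)) = L * \<epsilon>"
      by (simp add: L_def \<omega>_def sum_distrib_left[symmetric] algebra_simps)
    have s2: "(\<Sum>i\<in>J. M2 * \<epsilon> * norm (w i)) \<ge> 0" using M2(1) \<epsilon> by (intro sum_nonneg) simp
    have "derivative_bound (1/4 + (\<Sum>i\<in>J. M1 * \<epsilon> * norm (w i))) u"
      unfolding u_def by (rule derivative_bound_add[OF contraction b1])
    then have bu: "derivative_bound (1/2) u" by (rule derivative_bound_mono) (use s s2 L\<epsilon> in linarith)
    have "derivative_bound (1/4 + (\<Sum>i\<in>J. M1 * \<epsilon> * norm (w i)) + (\<Sum>i\<in>J. M2 * \<epsilon> * norm (w i))) v"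
      unfolding v_def u_def by (rule derivative_bound_add[OF derivative_bound_add[OF contraction b1] b2])
    then have bv: "derivative_bound (1/2) v" by (rule derivative_bound_mono) (use s L\<epsilon> in linarith)
    obtain E where E: "ambient_diffeo (\<lambda>y. y + u y) E"
      using bu by (rule identity_plus_contraction_ambient_diffeo) simp_all
    obtain F where F: "ambient_diffeo (\<lambda>y. y + v y) F"
      using bv by (rule identity_plus_contraction_ambient_diffeo) simp_all
    define \<Phi> where "\<Phi> y = F (y + u y)" for y
    have amb: "ambient_diffeo \<Phi> (\<lambda>z. E (z + v z))"
      unfolding \<Phi>_def by (rule ambient_diffeo_compose[OF E ambient_diffeo_sym[OF F]])
    have eq: "\<Phi> y + v (\<Phi> y) = y + u y" for y using F by (simp add: ambient_diffeo_def \<Phi>_def)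
    have fix1: "\<Phi> y = y" if "\<rho> y = 0" for y
    proof -
      have "y + u y = y + v y" using that by (simp add: v_def)
      then show ?thesis using F by (simp add: ambient_diffeo_def \<Phi>_def)
    qed
    \<comment> \<open>The counterpart of \<open>fix1\<close> at the image point: if \<rho> is
      nonzero at \<open>y\<close>, it is nonzero at \<open>\<Phi> y\<close>, so both points lie in
      the ball.\<close>
    have fix2: "\<Phi> y = y" if "\<rho> (\<Phi> y) = 0" for y
    proof -
      have "\<Phi> y + u (\<Phi> y) = y + u y" using that eq[of y] by (simp add: v_def)
      then have "E (\<Phi> y + u (\<Phi> y)) = E (y + u y)" by (rule arg_cong)
      then show ?thesis using E by (simp add: ambient_diffeo_def)
    qed
    have nu: "n i \<bullet> (y + u y - p) = h i y + \<sigma> y * r i y"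
      and nv: "n i \<bullet> (y + v y - p) = h i y + (\<sigma> y + \<rho> y) * r i y"
      if y: "y \<in> ball p \<delta>" and i: "i \<in> J" for y i
    proof -
      have "\<beta> y = 1" using y by (intro \<beta>_1) simp
      then have u: "u y = (\<Sum>i\<in>J. (h i y - n i \<bullet> (y - p) + \<sigma> y * r i y) *\<^sub>R w i)"
        by (simp add: u_def sum.distrib[symmetric] algebra_simps)
      have v: "v y = (\<Sum>i\<in>J. (h i y - n i \<bullet> (y - p) + \<sigma> y * r i y + \<rho> y * r i y) *\<^sub>R w i)"
        unfolding v_def u by (simp add: sum.distrib[symmetric] algebra_simps)
      have "n i \<bullet> u y = h i y - n i \<bullet> (y - p) + \<sigma> y * r i y"
        unfolding u by (rule inner_dual_sum[OF fJ dual i])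
      then show "n i \<bullet> (y + u y - p) = h i y + \<sigma> y * r i y"
        by (simp add: inner_add_right inner_diff_right)
      have "n i \<bullet> v y = h i y - n i \<bullet> (y - p) + \<sigma> y * r i y + \<rho> y * r i y"
        unfolding v by (rule inner_dual_sum[OF fJ dual i])
      then show "n i \<bullet> (y + v y - p) = h i y + (\<sigma> y + \<rho> y) * r i y"
        by (simp add: inner_add_right inner_diff_right distrib_right)
    qed
    \<comment> \<open>The factor \<open>t\<close> will be \<sigma> at the original point and
      \<sigma> + \<rho> at its image.\<close>
    have neg: "h i y + t * r i y \<le> 0" if "i \<in> I - J" "y \<in> ball p \<delta>" "0 \<le> t" "t \<le> 1" for i y t
    proof -
      have y: "y \<in> ?K" using that(2) \<delta>_pos by simp
      have "\<bar>t * r i y\<bar> \<le> 1 * \<epsilon>"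
        unfolding abs_mult using that rK(1)[of i y] y by (intro mult_mono) auto
      then show ?thesis using inactive[OF that(1) y] \<epsilon>(2) by linarith
    qed
    have "(\<forall>i\<in>I. h i (\<Phi> y) + (\<sigma> (\<Phi> y) + \<rho> (\<Phi> y)) * r i (\<Phi> y) \<le> 0) \<longleftrightarrow>
        (\<forall>i\<in>I. h i y + \<sigma> y * r i y \<le> 0)" for y
    proof (cases "\<rho> y = 0")
      case True
      then show ?thesis using fix1[OF True] by simp
    next
      case False
      then have "\<rho> (\<Phi> y) \<noteq> 0" using fix2[of y] by auto
      then have y: "y \<in> ball p \<delta>" "\<Phi> y \<in> ball p \<delta>" using False \<rho>(4) by blast+
      have pos: "0 \<le> \<sigma> z + \<rho> z" for z using \<sigma>(2)[of z] \<rho>(2)[of z] by simp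
      \<comment> \<open>Pairing \<open>eq\<close> with \<open>n i\<close> gives equality of the
        active constraint values, not merely equal signs.\<close>
      have "h i (\<Phi> y) + (\<sigma> (\<Phi> y) + \<rho> (\<Phi> y)) * r i (\<Phi> y) = h i y + \<sigma> y * r i y" if "i \<in> J" for i
        using nu[OF y(1) that] nv[OF y(2) that] eq[of y] by simp
      moreover have "h i y + \<sigma> y * r i y \<le> 0" if "i \<in> I - J" for i
        by (rule neg[OF that y(1) \<sigma>(2,3)])
      moreover have "h i (\<Phi> y) + (\<sigma> (\<Phi> y) + \<rho> (\<Phi> y)) * r i (\<Phi> y) \<le> 0" if "i \<in> I - J" for i
        by (rule neg[OF that y(2) pos \<rho>(3)])
      ultimately show ?thesis using J_subset by (metis Diff_iff)
    qed
    then show "\<exists>\<Phi> G. ambient_diffeo \<Phi> G \<and>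
      (\<forall>y. (\<forall>i\<in>I. h i (\<Phi> y) + (\<sigma> (\<Phi> y) + \<rho> (\<Phi> y)) * r i (\<Phi> y) \<le> 0) \<longleftrightarrow>
           (\<forall>i\<in>I. h i y + \<sigma> y * r i y \<le> 0))"
      using amb by (intro exI conjI allI)
  qed
qed

section \<open>Switching on the perturbation\<close>

lemma cutoff_equivalent_refl: "cutoff_equivalent I h W \<sigma> \<sigma>"
proof -
  have "ambient_diffeo (\<lambda>y. y) (\<lambda>y. y)" by (simp add: ambient_diffeo_def smooth_on_ident)
  then show ?thesis unfolding cutoff_equivalent_def
    by (intro exI[of _ 1] conjI allI impI exI[of _ "\<lambda>y. y"]) auto
qed

lemma cutoff_equivalent_trans:
  assumes "cutoff_equivalent I h W \<rho> \<sigma>" "cutoff_equivalent I h W \<sigma> \<tau>"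
  shows "cutoff_equivalent I h W \<rho> \<tau>"
proof -
  let ?small = "\<lambda>\<epsilon> r. \<forall>i\<in>I. smooth_on UNIV (r i) \<and> (\<forall>y\<in>W. \<bar>r i y\<bar> \<le> \<epsilon> \<and> norm (gradient (r i) y) \<le> \<epsilon>)"
  let ?feas = "\<lambda>\<sigma> r y. \<forall>i\<in>I. h i y + \<sigma> y * r i y \<le> (0::real)"
  obtain \<epsilon>1 where 1: "\<epsilon>1 > 0"
    "\<And>r. ?small \<epsilon>1 r \<Longrightarrow> \<exists>\<Phi> G. ambient_diffeo \<Phi> G \<and> (\<forall>y. ?feas \<sigma> r (\<Phi> y) \<longleftrightarrow> ?feas \<rho> r y)"
    using assms(1) unfolding cutoff_equivalent_def by blast
  obtain \<epsilon>2 where 2: "\<epsilon>2 > 0"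
    "\<And>r. ?small \<epsilon>2 r \<Longrightarrow> \<exists>\<Phi> G. ambient_diffeo \<Phi> G \<and> (\<forall>y. ?feas \<tau> r (\<Phi> y) \<longleftrightarrow> ?feas \<sigma> r y)"
    using assms(2) unfolding cutoff_equivalent_def by blast
  show ?thesis unfolding cutoff_equivalent_def
  proof (intro exI[of _ "min \<epsilon>1 \<epsilon>2"] conjI allI impI)
    show "min \<epsilon>1 \<epsilon>2 > 0" using 1(1) 2(1) by simp
    fix r assume "?small (min \<epsilon>1 \<epsilon>2) r"
    then have "?small \<epsilon>1 r" "?small \<epsilon>2 r" by auto
    then obtain \<Phi> G \<Phi>' G' where
      "ambient_diffeo \<Phi> G" "\<forall>y. ?feas \<sigma> r (\<Phi> y) \<longleftrightarrow> ?feas \<rho> r y"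
      "ambient_diffeo \<Phi>' G'" "\<forall>y. ?feas \<tau> r (\<Phi>' y) \<longleftrightarrow> ?feas \<sigma> r y"
      using 1(2)[of r] 2(2)[of r] by blast
    then show "\<exists>\<Phi> G. ambient_diffeo \<Phi> G \<and> (\<forall>y. ?feas \<tau> r (\<Phi> y) \<longleftrightarrow> ?feas \<rho> r y)"
      using ambient_diffeo_compose[of \<Phi> G \<Phi>' G']
      by (intro exI[of _ "\<lambda>y. \<Phi>' (\<Phi> y)"] exI[of _ "\<lambda>z. G (G' z)"]) simp
  qed
qed

text \<open>The new cutoff satisfies \<open>1 - \<tau> = (1 - \<sigma>) * (1 - \<theta>)\<close>: it
  stays between 0 and 1 and equals 1 wherever \<sigma> or \<theta> does, so earlier progress is
  kept. \<open>V\<close> and \<theta> precede \<sigma> in the quantifiers; this lets a finite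
  subcover be chosen before any cutoff is built.\<close>

lemma cutoff_increment:
  fixes h :: "'i \<Rightarrow> real^'m \<Rightarrow> real" and p :: "real^'m"
  assumes I: "finite I" and h: "\<And>i. i \<in> I \<Longrightarrow> smooth_on UNIV (h i)" and hp: "\<And>i. i \<in> I \<Longrightarrow> h i p \<le> 0"
    and inj: "inj_on (\<lambda>i. gradient (h i) p) {i\<in>I. h i p = 0}"
    and ind: "independent ((\<lambda>i. gradient (h i) p) ` {i\<in>I. h i p = 0})"
    and W: "open W" "p \<in> W"
  shows "\<exists>V \<theta>. open V \<and> p \<in> V \<and> smooth_on UNIV \<theta> \<and> (\<forall>y. 0 \<le> \<theta> y \<and> \<theta> y \<le> 1) \<and>
    (\<forall>y\<in>V. \<theta> y = 1) \<and> (\<forall>y. y \<notin> W \<longrightarrow> \<theta> y = 0) \<and>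
    (\<forall>\<sigma>. smooth_on UNIV \<sigma> \<longrightarrow> (\<forall>y. 0 \<le> \<sigma> y \<and> \<sigma> y \<le> 1) \<longrightarrow>
      cutoff_equivalent I h W \<sigma> (\<lambda>y. \<sigma> y + (1 - \<sigma> y) * \<theta> y))"
proof -
  obtain w \<delta> c \<beta> A B e where
    "straightening I {i\<in>I. h i p = 0} h (\<lambda>i. gradient (h i) p) w p W \<delta> c \<beta> A B e"
    by (rule straightening_exists[OF I h hp refl inj ind W])
  then interpret straightening I "{i\<in>I. h i p = 0}" h "\<lambda>i. gradient (h i) p" w p W \<delta> c \<beta> A B e .
  \<comment> \<open>The support must lie in \<open>ball p \<delta>\<close>, where the straightening
    identities hold; the ratio 2 between support and plateau in \<open>bump_exists\<close> gives
    \<open>\<delta> / 2\<close>.\<close>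
  obtain \<theta> where \<theta>: "smooth_on UNIV \<theta>" "\<And>y. 0 \<le> \<theta> y" "\<And>y. \<theta> y \<le> 1"
    "\<And>y. y \<in> cball p (\<delta> / 2) \<Longrightarrow> \<theta> y = (1::real)" "\<And>y. y \<notin> ball p \<delta> \<Longrightarrow> \<theta> y = 0"
  proof -
    obtain C :: real where "\<And>(p :: real^'m) a. a > 0 \<Longrightarrow> \<exists>\<chi>'. smooth_on UNIV \<chi>' \<and> (\<forall>y. 0 \<le> \<chi>' y \<and> \<chi>' y \<le> 1) \<and>
       (\<forall>y\<in>cball p a. \<chi>' y = 1) \<and> (\<forall>y. y \<notin> ball p (2 * a) \<longrightarrow> \<chi>' y = 0) \<and>
       (\<forall>y v. \<bar>frechet_derivative \<chi>' (at y) v\<bar> \<le> C / a * norm v)"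
      by (rule bump_exists) (rule that)
    from this[of "\<delta> / 2" p] \<delta>_pos show thesis by (auto intro: that)
  qed
  have \<theta>W: "\<theta> y = 0" if "y \<notin> W" for y
  proof (rule \<theta>(5))
    have "ball p \<delta> \<subseteq> cball p (2 * \<delta>)" using \<delta>_pos by auto
    then show "y \<notin> ball p \<delta>" using that cball_W by blast
  qed
  have "cutoff_equivalent I h W \<sigma> (\<lambda>y. \<sigma> y + (1 - \<sigma> y) * \<theta> y)"
    if \<sigma>: "smooth_on UNIV \<sigma>" "\<forall>y. 0 \<le> \<sigma> y \<and> \<sigma> y \<le> 1" for \<sigma>
  proof (rule cutoff_perturbation_step)
    show "smooth_on UNIV (\<lambda>y. (1 - \<sigma> y) * \<theta> y)"
      by (intro smooth_on_mult smooth_on_diff smooth_on_const \<sigma> \<theta>)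
    show "0 \<le> (1 - \<sigma> y) * \<theta> y" for y using \<sigma>(2) \<theta>(2) by simp
    show "\<sigma> y + (1 - \<sigma> y) * \<theta> y \<le> 1" for y
    proof -
      have "(1 - \<sigma> y) * \<theta> y \<le> (1 - \<sigma> y) * 1" using \<sigma>(2) \<theta>(3) by (intro mult_left_mono) auto
      then show ?thesis by simp
    qed
    show "(1 - \<sigma> y) * \<theta> y = 0" if "y \<notin> ball p \<delta>" for y using \<theta>(5)[OF that] by simp
  qed (use \<sigma> in simp_all)
  moreover have "\<forall>y\<in>ball p (\<delta> / 2). \<theta> y = 1" using \<theta>(4) by simp
  ultimately show ?thesis
    using \<theta>(1-3) \<theta>W \<delta>_pos by (intro exI[of _ "ball p (\<delta> / 2)"] exI[of _ \<theta>]) simp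
qed

text \<open>In the end \<open>1 - \<sigma>\<close> is the product of the factors
  \<open>1 - \<theta> p\<close>, which vanishes on every \<open>V p\<close> and is 1 outside
  \<open>W\<close>.\<close>

lemma cutoff_cover:
  fixes V :: "'p \<Rightarrow> 'a::euclidean_space set"
  assumes "finite D"
    and \<theta>: "\<And>p. p \<in> D \<Longrightarrow> smooth_on UNIV (\<theta> p)" "\<And>p y. p \<in> D \<Longrightarrow> 0 \<le> \<theta> p y \<and> \<theta> p y \<le> 1"
      "\<And>p y. p \<in> D \<Longrightarrow> y \<in> V p \<Longrightarrow> \<theta> p y = 1" "\<And>p y. p \<in> D \<Longrightarrow> y \<notin> W \<Longrightarrow> \<theta> p y = 0"
    and step: "\<And>p \<sigma>. p \<in> D \<Longrightarrow> smooth_on UNIV \<sigma> \<Longrightarrow> (\<forall>y. 0 \<le> \<sigma> y \<and> \<sigma> y \<le> 1) \<Longrightarrow>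
      cutoff_equivalent I h W \<sigma> (\<lambda>y. \<sigma> y + (1 - \<sigma> y) * \<theta> p y)"
  shows "\<exists>\<sigma>. smooth_on UNIV \<sigma> \<and> (\<forall>y. 0 \<le> \<sigma> y \<and> \<sigma> y \<le> 1) \<and> (\<forall>y\<in>(\<Union>p\<in>D. V p). \<sigma> y = 1) \<and>
    (\<forall>y. y \<notin> W \<longrightarrow> \<sigma> y = 0) \<and> cutoff_equivalent I h W (\<lambda>_. 0) \<sigma>"
  using assms
proof (induction D rule: finite_induct)
  case empty
  show ?case
    by (rule exI[of _ "\<lambda>_. 0"]) (simp add: smooth_on_const cutoff_equivalent_refl)
next
  case (insert p D)
  have "\<exists>\<sigma>. smooth_on UNIV \<sigma> \<and> (\<forall>y. 0 \<le> \<sigma> y \<and> \<sigma> y \<le> 1) \<and> (\<forall>y\<in>(\<Union>p\<in>D. V p). \<sigma> y = 1) \<and>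
    (\<forall>y. y \<notin> W \<longrightarrow> \<sigma> y = 0) \<and> cutoff_equivalent I h W (\<lambda>_. 0) \<sigma>"
    by (rule insert.IH) (simp_all add: insert.prems)
  then obtain \<sigma> where \<sigma>: "smooth_on UNIV \<sigma>" "\<forall>y. 0 \<le> \<sigma> y \<and> \<sigma> y \<le> 1"
    "\<And>y. y \<in> (\<Union>p\<in>D. V p) \<Longrightarrow> \<sigma> y = 1" "\<And>y. y \<notin> W \<Longrightarrow> \<sigma> y = 0" "cutoff_equivalent I h W (\<lambda>_. 0) \<sigma>"
    by blast
  define \<tau> where "\<tau> y = \<sigma> y + (1 - \<sigma> y) * \<theta> p y" for y
  have p: "p \<in> insert p D" by simp
  have "smooth_on UNIV \<tau>" unfolding \<tau>_def
    by (intro smooth_on_add smooth_on_mult smooth_on_diff smooth_on_const \<sigma>(1) insert.prems(1) p)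
  moreover have "0 \<le> \<tau> y \<and> \<tau> y \<le> 1" for y
  proof
    show "0 \<le> \<tau> y" using \<sigma>(2) insert.prems(2)[OF p, of y] by (simp add: \<tau>_def)
    have "(1 - \<sigma> y) * \<theta> p y \<le> (1 - \<sigma> y) * 1"
      using \<sigma>(2) insert.prems(2)[OF p, of y] by (intro mult_left_mono) auto
    then show "\<tau> y \<le> 1" by (simp add: \<tau>_def)
  qed
  moreover have "\<tau> y = 1" if "y \<in> (\<Union>p\<in>insert p D. V p)" for y
  proof (cases "y \<in> V p")
    case True
    then show ?thesis using insert.prems(3)[OF p True] by (simp add: \<tau>_def)
  next
    case False
    then have "y \<in> (\<Union>p\<in>D. V p)" using that by simp
    then show ?thesis using \<sigma>(3) by (simp add: \<tau>_def)
  qed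
  moreover have "\<tau> y = 0" if "y \<notin> W" for y
    using \<sigma>(4)[OF that] insert.prems(4)[OF p that] by (simp add: \<tau>_def)
  moreover have "cutoff_equivalent I h W (\<lambda>_. 0) \<tau>"
    unfolding \<tau>_def[abs_def] using \<sigma>(5) insert.prems(5)[OF p \<sigma>(1,2)] by (rule cutoff_equivalent_trans)
  ultimately show ?case by blast
qed

text \<open>Which constraint is violated depends on the point, so the constraints are combined: the
  sum of their positive parts is continuous and positive on \<open>C\<close>, and its minimum is
  distributed over the indices.\<close>

lemma positive_gap_on_compact:
  fixes h :: "'i \<Rightarrow> 'a::euclidean_space \<Rightarrow> real"
  assumes I: "finite I" and h: "\<And>i. i \<in> I \<Longrightarrow> continuous_on C (h i)" and C: "compact C"
    and infeasible: "\<And>y. y \<in> C \<Longrightarrow> \<exists>i\<in>I. h i y > 0"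
  obtains c where "c > 0" "\<And>y. y \<in> C \<Longrightarrow> \<exists>i\<in>I. h i y > c"
proof (cases "C = {}")
  case True
  show thesis by (rule that[of 1]) (simp_all add: True)
next
  case False
  let ?g = "\<lambda>y. \<Sum>i\<in>I. max 0 (h i y)"
  have "continuous_on C ?g" by (intro continuous_on_sum continuous_on_max continuous_on_const h)
  then obtain z where z: "z \<in> C" "\<And>y. y \<in> C \<Longrightarrow> ?g z \<le> ?g y"
    using continuous_attains_inf[OF C False] by blast
  have "?g z > 0"
  proof -
    obtain i where "i \<in> I" "h i z > 0" using infeasible[OF z(1)] by blast
    then show ?thesis using I by (intro sum_pos2[of I i]) auto
  qed
  \<comment> \<open>The extra 1 yields the strict inequality behind the contradiction below.\<close>
  define c where "c = ?g z / (real (card I) + 1)"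
  have c: "c > 0" using \<open>?g z > 0\<close> by (simp add: c_def)
  have "\<exists>i\<in>I. h i y > c" if y: "y \<in> C" for y
  proof (rule ccontr)
    assume "\<not> (\<exists>i\<in>I. h i y > c)"
    then have "max 0 (h i y) \<le> c" if "i \<in> I" for i using that c by force
    then have "?g y \<le> real (card I) * c" using sum_bounded_above[of I "\<lambda>i. max 0 (h i y)" c] by simp
    also have "\<dots> < (real (card I) + 1) * c" using c by simp
    also have "\<dots> = ?g z" by (simp add: c_def)
    finally show False using z(2)[OF y] by simp
  qed
  with c show thesis by (rule that)
qed

lemma feasible_perturbation_diffeo:
  fixes h :: "'i \<Rightarrow> real^'m \<Rightarrow> real"
  assumes I: "finite I" and h: "\<And>i. i \<in> I \<Longrightarrow> smooth_on UNIV (h i)"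
    and K: "compact K" "{y. \<forall>i\<in>I. h i y \<le> 0} \<subseteq> interior K"
    and inj: "\<And>p. (\<forall>i\<in>I. h i p \<le> 0) \<Longrightarrow> inj_on (\<lambda>i. gradient (h i) p) {i\<in>I. h i p = 0}"
    and ind: "\<And>p. (\<forall>i\<in>I. h i p \<le> 0) \<Longrightarrow> independent ((\<lambda>i. gradient (h i) p) ` {i\<in>I. h i p = 0})"
  shows "\<exists>\<epsilon>>0. \<forall>r. (\<forall>i\<in>I. smooth_on UNIV (r i) \<and> (\<forall>y\<in>K. \<bar>r i y\<bar> \<le> \<epsilon> \<and> norm (gradient (r i) y) \<le> \<epsilon>)) \<longrightarrow>
      (\<exists>\<Phi> G. ambient_diffeo \<Phi> G \<and>
        \<Phi> ` {y. \<forall>i\<in>I. h i y \<le> 0} = {y\<in>K. \<forall>i\<in>I. h i y + r i y \<le> 0})"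
proof -
  define Y where "Y = {y. \<forall>i\<in>I. h i y \<le> 0}"
  define W where "W = interior K"
  have YW: "Y \<subseteq> W" and WK: "W \<subseteq> K" using K(2) interior_subset by (auto simp: Y_def W_def)
  have hc: "continuous_on S (h i)" if "i \<in> I" for i S using h[OF that] by (rule smooth_on_UNIV_continuous)
  have "Y = (\<Inter>i\<in>I. {y. h i y \<le> 0})" by (auto simp: Y_def)
  moreover have "closed (\<Inter>i\<in>I. {y. h i y \<le> 0})"
    by (intro closed_INT ballI closed_Collect_le hc continuous_on_const)
  ultimately have cY: "compact Y"
    using compact_Int_closed[OF K(1), of Y] YW WK by (simp add: Int_absorb1 subset_trans)
  have "\<forall>p\<in>Y. \<exists>V \<theta>. open V \<and> p \<in> V \<and> smooth_on UNIV \<theta> \<and> (\<forall>y. 0 \<le> \<theta> y \<and> \<theta> y \<le> 1) \<and>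
    (\<forall>y\<in>V. \<theta> y = 1) \<and> (\<forall>y. y \<notin> W \<longrightarrow> \<theta> y = 0) \<and>
    (\<forall>\<sigma>. smooth_on UNIV \<sigma> \<longrightarrow> (\<forall>y. 0 \<le> \<sigma> y \<and> \<sigma> y \<le> 1) \<longrightarrow>
      cutoff_equivalent I h W \<sigma> (\<lambda>y. \<sigma> y + (1 - \<sigma> y) * \<theta> y))"
  proof
    fix p assume p: "p \<in> Y"
    then have f: "\<forall>i\<in>I. h i p \<le> 0" by (simp add: Y_def)
    show "\<exists>V \<theta>. open V \<and> p \<in> V \<and> smooth_on UNIV \<theta> \<and> (\<forall>y. 0 \<le> \<theta> y \<and> \<theta> y \<le> 1) \<and>
      (\<forall>y\<in>V. \<theta> y = 1) \<and> (\<forall>y. y \<notin> W \<longrightarrow> \<theta> y = 0) \<and>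
      (\<forall>\<sigma>. smooth_on UNIV \<sigma> \<longrightarrow> (\<forall>y. 0 \<le> \<sigma> y \<and> \<sigma> y \<le> 1) \<longrightarrow>
        cutoff_equivalent I h W \<sigma> (\<lambda>y. \<sigma> y + (1 - \<sigma> y) * \<theta> y))"
    proof (rule cutoff_increment[OF I h _ inj[OF f] ind[OF f]])
      show "open W" by (simp add: W_def)
      show "p \<in> W" using p YW by blast
    qed (use f in simp_all)
  qed
  then obtain V \<theta> where V: "\<forall>p\<in>Y. open (V p) \<and> p \<in> V p \<and> smooth_on UNIV (\<theta> p) \<and>
    (\<forall>y. 0 \<le> \<theta> p y \<and> \<theta> p y \<le> 1) \<and> (\<forall>y\<in>V p. \<theta> p y = 1) \<and> (\<forall>y. y \<notin> W \<longrightarrow> \<theta> p y = 0) \<and>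
    (\<forall>\<sigma>. smooth_on UNIV \<sigma> \<longrightarrow> (\<forall>y. 0 \<le> \<sigma> y \<and> \<sigma> y \<le> 1) \<longrightarrow>
      cutoff_equivalent I h W \<sigma> (\<lambda>y. \<sigma> y + (1 - \<sigma> y) * \<theta> p y))"
    unfolding bchoice_iff by blast
  obtain D where D: "D \<subseteq> Y" "finite D" "Y \<subseteq> (\<Union>p\<in>D. V p)"
    by (rule compactE_image[OF cY, of Y V]) (use V in auto)
  define N where "N = (\<Union>p\<in>D. V p)"
  have "\<exists>\<sigma>. smooth_on UNIV \<sigma> \<and> (\<forall>y. 0 \<le> \<sigma> y \<and> \<sigma> y \<le> 1) \<and> (\<forall>y\<in>(\<Union>p\<in>D. V p). \<sigma> y = 1) \<and>
    (\<forall>y. y \<notin> W \<longrightarrow> \<sigma> y = 0) \<and> cutoff_equivalent I h W (\<lambda>_. 0) \<sigma>"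
  proof (rule cutoff_cover[OF D(2)])
    fix p assume "p \<in> D"
    then have p: "p \<in> Y" using D(1) by blast
    show "smooth_on UNIV (\<theta> p)" "0 \<le> \<theta> p y \<and> \<theta> p y \<le> 1" "y \<in> V p \<Longrightarrow> \<theta> p y = 1"
      "y \<notin> W \<Longrightarrow> \<theta> p y = 0" for y
      using V[rule_format, OF p] by simp_all
    show "cutoff_equivalent I h W \<sigma> (\<lambda>y. \<sigma> y + (1 - \<sigma> y) * \<theta> p y)"
      if "smooth_on UNIV \<sigma>" "\<forall>y. 0 \<le> \<sigma> y \<and> \<sigma> y \<le> 1" for \<sigma>
      using V[rule_format, OF p] that by simp
  qed
  then obtain \<sigma> where \<sigma>: "\<And>y. 0 \<le> \<sigma> y" "\<And>y. \<sigma> y \<le> 1" "\<And>y. y \<in> N \<Longrightarrow> \<sigma> y = 1"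
    "\<And>y. y \<notin> W \<Longrightarrow> \<sigma> y = 0" "cutoff_equivalent I h W (\<lambda>_. 0) \<sigma>"
    unfolding N_def by blast
  have "open N" unfolding N_def using V D(1) by blast
  then have "compact (K - N)" using K(1) by (simp add: compact_diff)
  moreover have "\<exists>i\<in>I. h i y > 0" if "y \<in> K - N" for y
    using that D(3) by (force simp: N_def Y_def)
  ultimately obtain c where c: "c > 0" "\<And>y. y \<in> K - N \<Longrightarrow> \<exists>i\<in>I. h i y > c"
    using positive_gap_on_compact[of I "K - N" h, OF I hc] by blast
  obtain \<epsilon>0 where \<epsilon>0: "\<epsilon>0 > 0"
    "\<And>r. \<forall>i\<in>I. smooth_on UNIV (r i) \<and> (\<forall>y\<in>W. \<bar>r i y\<bar> \<le> \<epsilon>0 \<and> norm (gradient (r i) y) \<le> \<epsilon>0) \<Longrightarrow>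
      \<exists>\<Phi> G. ambient_diffeo \<Phi> G \<and>
        (\<forall>y. (\<forall>i\<in>I. h i (\<Phi> y) + \<sigma> (\<Phi> y) * r i (\<Phi> y) \<le> 0) \<longleftrightarrow> (\<forall>i\<in>I. h i y + 0 * r i y \<le> 0))"
    using \<sigma>(5) unfolding cutoff_equivalent_def by blast
  \<comment> \<open>Besides the bound \<epsilon>0 from the chain of cutoffs, \<open>c\<close> keeps
    the perturbation from outweighing the violation on \<open>K - N\<close>.\<close>
  show ?thesis
  proof (intro exI[of _ "min \<epsilon>0 c"] conjI allI impI)
    show "min \<epsilon>0 c > 0" using \<epsilon>0(1) c(1) by simp
    fix r assume small: "\<forall>i\<in>I. smooth_on UNIV (r i) \<and>
      (\<forall>y\<in>K. \<bar>r i y\<bar> \<le> min \<epsilon>0 c \<and> norm (gradient (r i) y) \<le> min \<epsilon>0 c)"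
    then have r: "\<And>i. i \<in> I \<Longrightarrow> smooth_on UNIV (r i)"
      "\<And>i y. i \<in> I \<Longrightarrow> y \<in> K \<Longrightarrow> \<bar>r i y\<bar> \<le> min \<epsilon>0 c \<and> norm (gradient (r i) y) \<le> min \<epsilon>0 c"
      by blast+
    have "\<forall>i\<in>I. smooth_on UNIV (r i) \<and> (\<forall>y\<in>W. \<bar>r i y\<bar> \<le> \<epsilon>0 \<and> norm (gradient (r i) y) \<le> \<epsilon>0)"
    proof (intro ballI conjI)
      fix i y assume "i \<in> I" "y \<in> W"
      then show "\<bar>r i y\<bar> \<le> \<epsilon>0" "norm (gradient (r i) y) \<le> \<epsilon>0"
        using r(2)[of i y] WK by auto
    qed (rule r)
    from \<epsilon>0(2)[OF this] obtain \<Phi> G where amb: "ambient_diffeo \<Phi> G" and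
      \<Phi>: "\<And>y. (\<forall>i\<in>I. h i (\<Phi> y) + \<sigma> (\<Phi> y) * r i (\<Phi> y) \<le> 0) \<longleftrightarrow> (\<forall>i\<in>I. h i y \<le> 0)"
      by auto
    \<comment> \<open>Used with \<open>t = \<sigma> z\<close> for the cut-off constraints and with
      \<open>t = 1\<close> for the fully perturbed ones.\<close>
    have gap: "\<exists>i\<in>I. h i y + t * r i y > 0" if y: "y \<in> K - N" and t: "0 \<le> t" "t \<le> 1" for y t
    proof -
      obtain i where i: "i \<in> I" "h i y > c" using c(2)[OF y] by blast
      have "\<bar>t * r i y\<bar> \<le> 1 * c"
        unfolding abs_mult using t r(2)[OF i(1), of y] y by (intro mult_mono) auto
      then have "h i y + t * r i y > 0" using i(2) by linarith
      then show ?thesis using i(1) by blast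
    qed
    have feas: "(\<forall>i\<in>I. h i z + \<sigma> z * r i z \<le> 0) \<longleftrightarrow> z \<in> K \<and> (\<forall>i\<in>I. h i z + r i z \<le> 0)" for z
    proof -
      \<comment> \<open>On \<open>N\<close> the cutoff is 1, and since it vanishes off
        \<open>W\<close> the point lies in \<open>K\<close>; on \<open>K - N\<close> both sides fail
        by \<open>gap\<close>; outside \<open>K\<close> the cutoff is 0 and the left side would put
        \<open>z\<close> into \<open>Y\<close>.\<close>
      consider "z \<in> N" | "z \<in> K - N" | "z \<notin> K" "z \<notin> N" by blast
      then show ?thesis
      proof cases
        case 1
        then have "\<sigma> z = 1" by (rule \<sigma>(3))
        moreover from this have "z \<in> K" using \<sigma>(4)[of z] WK by fastforce
        ultimately show ?thesis by simp
      next
        case 2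
        then show ?thesis using gap[OF 2 \<sigma>(1,2)[of z]] gap[OF 2, of 1] by fastforce
      next
        case 3
        then have "\<sigma> z = 0" using \<sigma>(4) WK by blast
        moreover have "z \<notin> Y" using 3(1) YW WK by blast
        ultimately show ?thesis using 3(1) by (simp add: Y_def)
      qed
    qed
    have "\<Phi> ` {y. \<forall>i\<in>I. h i y \<le> 0} = {y\<in>K. \<forall>i\<in>I. h i y + r i y \<le> 0}"
    proof (rule set_eqI)
      fix z
      have z: "\<Phi> (G z) = z" using amb by (simp add: ambient_diffeo_def)
      have "z \<in> \<Phi> ` {y. \<forall>i\<in>I. h i y \<le> 0} \<longleftrightarrow> (\<forall>i\<in>I. h i (G z) \<le> 0)"
        unfolding ambient_diffeo_image_eq[OF amb] by simp
      also have "\<dots> \<longleftrightarrow> (\<forall>i\<in>I. h i z + \<sigma> z * r i z \<le> 0)" using \<Phi>[of "G z"] unfolding z by simp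
      finally show "z \<in> \<Phi> ` {y. \<forall>i\<in>I. h i y \<le> 0} \<longleftrightarrow> z \<in> {y\<in>K. \<forall>i\<in>I. h i y + r i y \<le> 0}"
        using feas[of z] by simp
    qed
    with amb show "\<exists>\<Phi> G. ambient_diffeo \<Phi> G \<and>
        \<Phi> ` {y. \<forall>i\<in>I. h i y \<le> 0} = {y\<in>K. \<forall>i\<in>I. h i y + r i y \<le> 0}" by blast
  qed
qed

section \<open>From the parametric problem to a fixed parameter\<close>

lemma smooth_on_slice:
  fixes f :: "'a::euclidean_space \<Rightarrow> 'b::euclidean_space \<Rightarrow> 'c::euclidean_space"
  assumes "smooth_on (S \<times> UNIV) (\<lambda>(x, y). f x y)" "x \<in> S"
  shows "smooth_on UNIV (f x)"
proof -
  \<comment> \<open>The inclusion of the slice is written as a constant plus a linear map. It covers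
    all \<open>y\<close>, so smoothness relative to a set of parameters that need not be open
    becomes smoothness on the whole space.\<close>
  have "smooth_on UNIV (\<lambda>y::'b. (x, 0) + (0 :: 'a, y))"
    by (intro smooth_on_add smooth_on_const smooth_on_bounded_linear bounded_linear_Pair
        bounded_linear_zero bounded_linear_ident)
  then have "smooth_on UNIV (\<lambda>y::'b. (x, y))" by simp
  from smooth_on_compose[OF this assms(1)] assms(2) show ?thesis by auto
qed

text \<open>A real supremum bounds its members only if the set is bounded above, so continuity on
  the compact set is checked first; for the gradient it comes from the directional derivatives along
  the basis.\<close>

lemma C2_norm_on_bounds:
  assumes f: "smooth_on UNIV f" and K: "compact K" "y \<in> K"
  shows "\<bar>f y\<bar> \<le> C2_norm_on K f" "norm (gradient f y) \<le> C2_norm_on K f"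
proof -
  have "gradient f = (\<lambda>y. \<Sum>b\<in>Basis. frechet_derivative f (at y) b *\<^sub>R b)"
    unfolding frechet_derivative_gradient[OF f]
  proof
    show "gradient f y = (\<Sum>b\<in>Basis. (b \<bullet> gradient f y) *\<^sub>R b)" for y
      using euclidean_representation[of "gradient f y"] by (simp only: inner_commute)
  qed
  moreover have "continuous_on K (\<lambda>y. \<Sum>b\<in>Basis. frechet_derivative f (at y) b *\<^sub>R b)"
    by (intro continuous_on_sum continuous_on_scaleR continuous_on_const smooth_on_UNIV_continuous
        smooth_on_UNIV_frechet_derivative f)
  ultimately have "continuous_on K (gradient f)" by simp
  then have "bdd_above ((\<lambda>y. norm (gradient f y)) ` K)"
    by (intro bounded_imp_bdd_above compact_imp_bounded compact_continuous_image continuous_on_norm K)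
  then have 1: "norm (gradient f y) \<le> (SUP y\<in>K. norm (gradient f y))" using K(2) by (intro cSUP_upper)
  have "bdd_above ((\<lambda>y. \<bar>f y\<bar>) ` K)"
    by (intro bounded_imp_bdd_above compact_imp_bounded compact_continuous_image continuous_on_rabs K
        smooth_on_UNIV_continuous f)
  then have 2: "\<bar>f y\<bar> \<le> (SUP y\<in>K. \<bar>f y\<bar>)" using K(2) by (intro cSUP_upper)
  show "\<bar>f y\<bar> \<le> C2_norm_on K f" using 2 by (simp add: C2_norm_on_def le_max_iff_disj)
  show "norm (gradient f y) \<le> C2_norm_on K f" using 1 by (simp add: C2_norm_on_def le_max_iff_disj)
qed

text \<open>Every point supplies its own straightening, with \<open>W = UNIV\<close> since only a
  chart is wanted. Only inequalities occur, so the dimension is that of the whole space.\<close>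

lemma manifold_gb_feasible:
  fixes h :: "'i \<Rightarrow> real^'m \<Rightarrow> real"
  assumes "finite I" "\<And>i. i \<in> I \<Longrightarrow> smooth_on UNIV (h i)"
    and "\<And>p. (\<forall>i\<in>I. h i p \<le> 0) \<Longrightarrow> inj_on (\<lambda>i. gradient (h i) p) {i\<in>I. h i p = 0}"
    and "\<And>p. (\<forall>i\<in>I. h i p \<le> 0) \<Longrightarrow> independent ((\<lambda>i. gradient (h i) p) ` {i\<in>I. h i p = 0})"
  shows "manifold_gb CARD('m) {y. \<forall>i\<in>I. h i y \<le> 0}"
  unfolding manifold_gb_def
proof
  fix p assume "p \<in> {y. \<forall>i\<in>I. h i y \<le> 0}"
  then have f: "\<forall>i\<in>I. h i p \<le> 0" by simp
  obtain w \<delta> c \<beta> A B e where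
    "straightening I {i\<in>I. h i p = 0} h (\<lambda>i. gradient (h i) p) w p UNIV \<delta> c \<beta> A B e"
    by (rule straightening_exists[OF assms(1,2) _ refl assms(3)[OF f] assms(4)[OF f] open_UNIV UNIV_I])
      (use f in auto)
  then have "mgb_at {y. \<forall>i\<in>I. h i y \<le> 0} p 0 (card {i\<in>I. h i p = 0})"
    by (rule straightening.mgb_at_feasible)
  then show "\<exists>q p'. q + CARD('m) = CARD('m) \<and> mgb_at {y. \<forall>i\<in>I. h i y \<le> 0} p q p'"
    by (intro exI[of _ 0] exI) simp
qed

theorem theorem2p2:
  fixes XX :: "(real^'n) set"
    and g :: "real^'n \<Rightarrow> real^'m \<Rightarrow> real"
    and h :: "nat \<Rightarrow> real^'n \<Rightarrow> real^'m \<Rightarrow> real"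
    and k :: nat
    and x :: "real^'n"
    and K_in K_out :: "(real^'m) set"
  assumes "smooth_on (XX \<times> UNIV) (\<lambda>(x, y). g x y)"
    and "\<forall>i\<in>{1..k}. smooth_on (XX \<times> UNIV) (\<lambda>(x, y). h i x y)"
    and "\<forall>x\<in>XX. feasible k h x \<noteq> {}"
    and "x \<in> XX"
    and "bounded (feasible k h x)"
    and "LICQ k h x"
    and "compact K_in" and "compact K_out"
    and "feasible k h x \<subseteq> interior K_in"
    and "K_in \<subseteq> interior K_out"
  shows "\<exists>\<epsilon>>0. \<forall>r :: nat \<Rightarrow> real^'n \<Rightarrow> real^'m \<Rightarrow> real.
     (\<forall>i\<in>{1..k}. smooth_on (XX \<times> UNIV) (\<lambda>(x, y). r i x y)) \<longrightarrow>
     (MAX i\<in>{1..k}. C2_norm_on K_out (r i x)) \<le> \<epsilon> \<longrightarrow>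
     (let Y = feasible k h x;
          Y' = feasible k (\<lambda>i x y. h i x y + r i x y) x \<inter> K_in
      in \<exists>s. manifold_gb s Y \<and> manifold_gb s Y' \<and>
             (\<exists>\<phi>. diffeomorphism \<phi> Y Y' \<and> stratification_preserving s \<phi> Y Y'))"
proof -
  let ?I = "{1..k}"
  have h: "smooth_on UNIV (h i x)" if "i \<in> ?I" for i
    using assms(2,4) that by (blast intro: smooth_on_slice)
  have Y: "feasible k h x = {y. \<forall>i\<in>?I. h i x y \<le> 0}" by (simp add: feasible_def)
  have inj: "inj_on (\<lambda>i. gradient (h i x) p) {i\<in>?I. h i x p = 0}"
    and ind: "independent ((\<lambda>i. gradient (h i x) p) ` {i\<in>?I. h i x p = 0})"
    if "\<forall>i\<in>?I. h i x p \<le> 0" for p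
  proof -
    have "p \<in> feasible k h x" unfolding Y using that by (rule CollectI)
    then show "inj_on (\<lambda>i. gradient (h i x) p) {i\<in>?I. h i x p = 0}"
      "independent ((\<lambda>i. gradient (h i x) p) ` {i\<in>?I. h i x p = 0})"
      using assms(6) unfolding LICQ_def active_def by blast+
  qed
  \<comment> \<open>The compact set of the lemma is \<open>K_in\<close>; the norm over
    \<open>K_out\<close> dominates the values and gradients on it.\<close>
  have "\<exists>\<epsilon>>0. \<forall>r. (\<forall>i\<in>?I. smooth_on UNIV (r i) \<and>
      (\<forall>y\<in>K_in. \<bar>r i y\<bar> \<le> \<epsilon> \<and> norm (gradient (r i) y) \<le> \<epsilon>)) \<longrightarrow>
      (\<exists>\<Phi> G. ambient_diffeo \<Phi> G \<and>
        \<Phi> ` {y. \<forall>i\<in>?I. h i x y \<le> 0} = {y\<in>K_in. \<forall>i\<in>?I. h i x y + r i y \<le> 0})"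
    by (rule feasible_perturbation_diffeo[OF finite_atLeastAtMost h assms(7) assms(9)[unfolded Y] inj ind])
  then obtain \<epsilon> where \<epsilon>: "\<epsilon> > 0"
    "\<And>r. \<forall>i\<in>?I. smooth_on UNIV (r i) \<and> (\<forall>y\<in>K_in. \<bar>r i y\<bar> \<le> \<epsilon> \<and> norm (gradient (r i) y) \<le> \<epsilon>) \<Longrightarrow>
      \<exists>\<Phi> G. ambient_diffeo \<Phi> G \<and>
        \<Phi> ` {y. \<forall>i\<in>?I. h i x y \<le> 0} = {y\<in>K_in. \<forall>i\<in>?I. h i x y + r i y \<le> 0}"
    by blast
  show ?thesis
  proof (intro exI[of _ \<epsilon>] conjI allI impI)
    show "\<epsilon> > 0" by (rule \<epsilon>)
    fix r :: "nat \<Rightarrow> real^'n \<Rightarrow> real^'m \<Rightarrow> real"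
    assume r: "\<forall>i\<in>?I. smooth_on (XX \<times> UNIV) (\<lambda>(x, y). r i x y)"
      and small: "(MAX i\<in>?I. C2_norm_on K_out (r i x)) \<le> \<epsilon>"
    have sr: "smooth_on UNIV (r i x)" if "i \<in> ?I" for i
      using r assms(4) that by (blast intro: smooth_on_slice)
    have bd: "\<bar>r i x y\<bar> \<le> \<epsilon> \<and> norm (gradient (r i x) y) \<le> \<epsilon>" if "i \<in> ?I" "y \<in> K_in" for i y
    proof -
      \<comment> \<open>Having an index \<open>i\<close> makes this a maximum over a nonempty finite
        set; for \<open>k = 0\<close> there is nothing to bound.\<close>
      have "C2_norm_on K_out (r i x) \<le> (MAX i\<in>?I. C2_norm_on K_out (r i x))"
        using that(1) by (intro Max_ge) auto
      then have "C2_norm_on K_out (r i x) \<le> \<epsilon>" using small by linarith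
      moreover have "y \<in> K_out" using that(2) assms(10) interior_subset by blast
      ultimately show ?thesis using C2_norm_on_bounds[OF sr[OF that(1)] assms(8), of y] by linarith
    qed
    obtain \<Phi> G where amb: "ambient_diffeo \<Phi> G"
      and im: "\<Phi> ` {y. \<forall>i\<in>?I. h i x y \<le> 0} = {y\<in>K_in. \<forall>i\<in>?I. h i x y + r i x y \<le> 0}"
      using \<epsilon>(2)[of "\<lambda>i. r i x"] sr bd by blast
    \<comment> \<open>Once the perturbed set is an image under \<open>\<Phi>\<close>, every
      remaining claim about it is transported from the original one.\<close>
    have Y': "feasible k (\<lambda>i x y. h i x y + r i x y) x \<inter> K_in = \<Phi> ` feasible k h x"
      unfolding Y im by (auto simp: feasible_def)
    have man: "manifold_gb CARD('m) (feasible k h x)"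
      unfolding Y by (rule manifold_gb_feasible[OF finite_atLeastAtMost h inj ind])
    show "let Y = feasible k h x;
          Y' = feasible k (\<lambda>i x y. h i x y + r i x y) x \<inter> K_in
      in \<exists>s. manifold_gb s Y \<and> manifold_gb s Y' \<and>
             (\<exists>\<phi>. diffeomorphism \<phi> Y Y' \<and> stratification_preserving s \<phi> Y Y')"
      unfolding Let_def Y'
      using man manifold_gb_ambient_diffeo[OF amb man] ambient_diffeo_diffeomorphism[OF amb]
        stratification_preserving_ambient_diffeo[OF amb]
      by (intro exI[of _ "CARD('m)"] exI[of _ \<Phi>] conjI)
  qed
qed

end
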